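(* Let $X_n$ denote the number of double deficiencies of a uniformly random permutation in $\operatorname{Av}_n(321)$. For $n\ge 2$, the support of $X_n$ is $\{0,1,\ldots,n-2\}$, and $$\mathbb E[X_n]=\frac{(n-1)(n-2)}{2(2n-1)},\qquad \operatorname{Var}(X_n)=\frac{(n+1)(n-2)(3n^2-8n+3)}{2(2n-1)^2(2n-3)}.$$ Moreover, as $n\to\infty$, $$d_{\mathrm{TV}}\left(\mathcal L(X_n),\operatorname{Bin}\left(n-2,\tfrac14\right)\right)=O\left(n^{-1/2}(\log n)^{1/4}\right).$$ In particular, $X_n$ is asymptotically normal.
   Context: $\mathfrak S_n$ is the set of permutations of $[n]=\{1,\dots,n\}$. $\operatorname{Av}_n(321)$ is the set of $\pi\in\mathfrak S_n$ with no subsequence order-isomorphic to $321$. An index $k\in[n]$ is a double deficiency of $\pi\in\mathfrak S_n$ if $\pi(k)<k<\pi^{-1}(k)$. $\mathcal L(X)$ is the law of $X$, $\operatorname{Bin}(m,p)$ is the binomial distribution, and for probability distributions $\mu,\nu$ on $\mathbb Z$, $d_{\mathrm{TV}}(\mu,\nu)=\frac12\sum_{j\in\mathbb Z}|\mu\{j\}-\nu\{j\}|$. Asymptotically normal means that $(X_n-\mathbb E[X_n])/\sqrt{\operatorname{Var}(X_n)}$ converges in distribution to the standard normal distribution as $n\to\infty$. *)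

theory Defs
  imports
    "HOL-Probability.Probability"
    "HOL-Combinatorics.Permutations"
    "HOL-Library.Sublist"
    "HOL-Library.Landau_Symbols"
begin

definition order_isomorphic :: "nat list \<Rightarrow> nat list \<Rightarrow> bool" where
  "order_isomorphic xs ys \<longleftrightarrow>
     length xs = length ys \<and>
     (\<forall>i<length xs. \<forall>j<length xs. xs ! i < xs ! j \<longleftrightarrow> ys ! i < ys ! j)"

text \<open>The list \<open>map p [1..<Suc n]\<close> is the one-line notation of a permutation \<open>p\<close> of
  \<open>{1..n}\<close>; functions satisfying \<open>p permutes {1..n}\<close> fix every other natural number, so
  permutations of \<open>{1..n}\<close> are counted once each.\<close>

definition Av :: "nat \<Rightarrow> nat list \<Rightarrow> (nat \<Rightarrow> nat) set" where
  "Av n w = {p. p permutes {1..n} \<and>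
     (\<nexists>xs. subseq xs (map p [1..<Suc n]) \<and> order_isomorphic xs w)}"

definition double_deficiency :: "nat \<Rightarrow> (nat \<Rightarrow> nat) \<Rightarrow> nat \<Rightarrow> bool" where
  "double_deficiency n p k \<longleftrightarrow> k \<in> {1..n} \<and> p k < k \<and> k < inv p k"

definition num_double_deficiencies :: "nat \<Rightarrow> (nat \<Rightarrow> nat) \<Rightarrow> nat" where
  "num_double_deficiencies n p = card {k. double_deficiency n p k}"

definition double_deficiency_law :: "nat \<Rightarrow> nat pmf" where
  "double_deficiency_law n =
     map_pmf (num_double_deficiencies n) (pmf_of_set (Av n [3, 2, 1]))"

definition d_TV :: "int pmf \<Rightarrow> int pmf \<Rightarrow> real" where
  "d_TV \<mu> \<nu> = 1 / 2 * (\<Sum>\<^sub>\<infinity>j. \<bar>pmf \<mu> j - pmf \<nu> j\<bar>)"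

text \<open>Where the variance is 0 the standardised variable is constantly 0, by division by zero;
  this is immaterial as long as it happens for finitely many indices only.\<close>

definition asymptotically_normal :: "(nat \<Rightarrow> nat pmf) \<Rightarrow> bool" where
  "asymptotically_normal X \<longleftrightarrow>
     weak_conv_m
       (\<lambda>n. distr (measure_pmf (X n)) borel
          (\<lambda>k. (real k - measure_pmf.expectation (X n) real)
                 / sqrt (measure_pmf.variance (X n) real)))
       std_normal_distribution"

lemma finite_Av: "finite (Av n w)"
  by (rule finite_subset[OF _ finite_permutations[of "{1..n}"]]) (auto simp: Av_def)

lemma mem_Av_321_iff:
  "p \<in> Av n [3, 2, 1] \<longleftrightarrow>
     p permutes {1..n} \<and>
     (\<nexists>i j k. 1 \<le> i \<and> i < j \<and> j < k \<and> k \<le> n \<and> p i > p j \<and> p j > p k)"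
proof -
  have iso: "order_isomorphic xs [3, 2, 1] \<longleftrightarrow> (\<exists>a b c. xs = [a, b, c] \<and> a > b \<and> b > c)" for xs
  proof
    assume iso: "order_isomorphic xs [3, 2, 1]"
    then obtain a b c where xs: "xs = [a, b, c]"
      by (auto simp: order_isomorphic_def numeral_3_eq_3 length_Suc_conv)
    from iso have cmp: "xs ! i < xs ! j \<longleftrightarrow> [3, 2, 1 :: nat] ! i < [3, 2, 1] ! j"
      if "i < 3" "j < 3" for i j
      using that xs by (simp add: order_isomorphic_def)
    have "b < a" "c < b"
      using cmp[of 1 0] cmp[of 2 1] xs by simp_all
    then show "\<exists>a b c. xs = [a, b, c] \<and> a > b \<and> b > c"
      using xs by simp
  next
    assume "\<exists>a b c. xs = [a, b, c] \<and> a > b \<and> b > c"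
    then show "order_isomorphic xs [3, 2, 1]"
      by (auto simp: order_isomorphic_def less_Suc_eq nth_Cons')
  qed
  have sub: "subseq [i, j, k] [1..<Suc n] \<longleftrightarrow> 1 \<le> i \<and> i < j \<and> j < k \<and> k \<le> n" for i j k
  proof
    assume s: "subseq [i, j, k] [1..<Suc n]"
    then obtain N where N: "[i, j, k] = nths [1..<Suc n] N"
      by (auto simp: subseq_conv_nths)
    have "sorted (nths [1..<Suc n] N)" "distinct (nths [1..<Suc n] N)"
      by (intro sorted_nths distinct_nthsI sorted_upt distinct_upt)+
    moreover have "set (nths [1..<Suc n] N) \<subseteq> {1..n}"
      using set_nths_subset[of "[1..<Suc n]" N] by auto
    ultimately show "1 \<le> i \<and> i < j \<and> j < k \<and> k \<le> n"
      unfolding N[symmetric] by auto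
  next
    assume a: "1 \<le> i \<and> i < j \<and> j < k \<and> k \<le> n"
    have app: "[l..<m] @ [m..<r] = [l..<r]" if "l \<le> m" "m \<le> r" for l m r :: nat
      using upt_add_eq_append[of l m "r - m"] that by simp
    have "[1..<Suc n] = [1..<i] @ [i..<j] @ [j..<k] @ [k..<Suc n]"
      using a by (simp add: app del: upt_Suc)
    also have "\<dots> = [1..<i] @ (i # [Suc i..<j]) @ (j # [Suc j..<k]) @ (k # [Suc k..<Suc n])"
      using a by (simp add: upt_conv_Cons del: upt_Suc)
    finally have e: "[1..<Suc n] = \<dots>" .
    have "subseq ([] @ ([i] @ [j] @ [k]))
            ([1..<i] @ (i # [Suc i..<j]) @ (j # [Suc j..<k]) @ (k # [Suc k..<Suc n]))"
      by (intro list_emb_append_mono) auto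
    then show "subseq [i, j, k] [1..<Suc n]"
      by (simp only: e append.simps)
  qed
  have "(\<exists>xs. subseq xs (map p [1..<Suc n]) \<and> order_isomorphic xs [3, 2, 1]) \<longleftrightarrow>
        (\<exists>i j k. 1 \<le> i \<and> i < j \<and> j < k \<and> k \<le> n \<and> p i > p j \<and> p j > p k)" (is "?L \<longleftrightarrow> ?R")
  proof
    assume ?L
    then obtain a b c where abc: "subseq [a, b, c] (map p [1..<Suc n])" "a > b" "b > c"
      unfolding iso by blast
    then obtain N where "[a, b, c] = map p (nths [1..<Suc n] N)"
      unfolding subseq_conv_nths nths_map by metis
    then obtain i j k where ijk: "[i, j, k] = nths [1..<Suc n] N" "a = p i" "b = p j" "c = p k"
      by (auto simp del: upt_Suc simp: Cons_eq_map_conv)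
    then have "subseq [i, j, k] [1..<Suc n]"
      unfolding subseq_conv_nths by blast
    with abc ijk show ?R unfolding sub by blast
  next
    assume ?R
    then obtain i j k where ijk: "subseq [i, j, k] [1..<Suc n]" "p i > p j" "p j > p k"
      unfolding sub by blast
    have "subseq (map p [i, j, k]) (map p [1..<Suc n])"
      using ijk(1) by (rule subseq_map)
    with ijk show ?L unfolding iso by auto
  qed
  then show ?thesis unfolding Av_def by blast
qed

lemma Av_321_nonempty: "Av n [3, 2, 1] \<noteq> {}"
proof -
  have "id \<in> Av n [3, 2, 1]"
    unfolding mem_Av_321_iff by (auto simp: permutes_id)
  then show ?thesis by blast
qed

end

theory Submission
  imports Defs "HOL-Computational_Algebra.Polynomial_FPS" "HOL-Real_Asymp.Real_Asymp"
begin

text \<open>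
  A permutation \<open>p\<close> that avoids 321 increases on the set \<open>E\<close> of positions with \<open>i < p i\<close> and also on the
  complement of \<open>E\<close>, so it is determined by \<open>E\<close> and the set of values \<open>V = p ` E\<close>
  (\<open>exc_pair_bij\<close>). Reading \<open>k = 1, \<dots>, n\<close>, let a step go up if \<open>k\<close> lies in \<open>E\<close> only, down if it lies in
  \<open>V\<close> only, and stay level, in one of two colours, if it lies in both or in neither. The result is a
  Motzkin path, and the double deficiencies are exactly the level steps of the colour
  ``neither'' at positive height. With weight \<open>q\<close> on those steps the paths are counted by coefficients of
  powers of \<open>1 + (1 + q) X + X\<^sup>2\<close> (\<open>path_gf_kernel\<close>); an argument of Lagrange inversion type makes the
  expression positive and yields the explicit numbers \<open>path_coeff\<close>. Support, mean and variance follow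
  from them by Vandermonde convolutions.

  For the comparison with the binomial law, the explicit formula is rewritten, for \<open>k \<ge> 1\<close>, as
  \<open>n! / k!\<close> times a sum over an auxiliary variable \<open>a\<close> with positive weights
  (\<open>path_coeff_stein_sum\<close>). The quotient of two neighbouring probabilities, divided by the same
  quotient for \<open>Bin(n - 2, 1/4)\<close>, is then an average of
  \<open>1 + 2 (M - 3 a) / M\<close> up to \<open>O(1/n)\<close>, where \<open>M = n - 2 - k\<close>. Two instances of a Stein type summation
  by parts show that \<open>M - 3 a\<close> has bounded mean (\<open>stein_mean_bound\<close>). Hence the density of the law with respect to the
  binomial law changes by a factor \<open>1 + O(1/n)\<close> per step in a window of width of order \<open>n\<close> around
  \<open>n / 4\<close>, hence by \<open>1 + O(n\<^sup>-\<^sup>1\<^sup>/\<^sup>2)\<close> over the typical range of width \<open>n\<^sup>1\<^sup>/\<^sup>2\<close>; since both laws have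
  variance \<open>O(n)\<close>, the total variation distance is \<open>O(n\<^sup>-\<^sup>1\<^sup>/\<^sup>2)\<close>
  (\<open>l1_distance_from_slow_ratio\<close>, \<open>law_binomial_l1\<close>).

  Asymptotic normality follows by Levy's continuity theorem: the characteristic function of the
  standardised variable differs from that of the binomial variable under the same affine map by at
  most the \<open>l\<^sup>1\<close> distance, and the binomial one is an explicit power.
\<close>

section \<open>321-avoiding permutations as bicoloured Motzkin paths\<close>

text \<open>A pair \<open>(E, V)\<close> encodes a path of length \<open>n\<close> from height 0 to height \<open>h\<close> whose height after \<open>k\<close> steps is
  \<open>card (E \<inter> {..k}) - card (V \<inter> {..k})\<close>. Counting \<open>E\<close> only below \<open>x\<close> and \<open>V\<close> up to \<open>x\<close> in the last condition
  forbids, besides negative heights, a level step of the colour ``both'' at height 0.\<close>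

definition motzkin_pairs :: "nat \<Rightarrow> nat \<Rightarrow> (nat set \<times> nat set) set" where
  "motzkin_pairs n h = {(E, V). E \<subseteq> {1..n} \<and> V \<subseteq> {1..n} \<and> card E = card V + h \<and>
     (\<forall>x\<in>{1..n}. card (V \<inter> {..x}) \<le> card (E \<inter> {..<x}))}"

text \<open>The statistic that becomes the number of double deficiencies: level steps of the colour
  ``neither'' at positive height. At height 0 such a step is a fixed point.\<close>

definition marked_levels :: "nat \<Rightarrow> nat set \<times> nat set \<Rightarrow> nat" where
  "marked_levels n = (\<lambda>(E, V). card {k \<in> {1..n}. k \<notin> E \<and> k \<notin> V \<and>
     card (V \<inter> {..k}) < card (E \<inter> {..k})})"

definition exc_pos :: "nat \<Rightarrow> (nat \<Rightarrow> nat) \<Rightarrow> nat set" where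
  "exc_pos n p = {i \<in> {1..n}. i < p i}"

definition exc_pair :: "nat \<Rightarrow> (nat \<Rightarrow> nat) \<Rightarrow> nat set \<times> nat set" where
  "exc_pair n p = (exc_pos n p, p ` exc_pos n p)"

lemma exc_pos_subset: "exc_pos n p \<subseteq> {1..n}" by (auto simp: exc_pos_def)

lemma Av_321_D:
  assumes "p \<in> Av n [3, 2, 1]" "1 \<le> i" "i < j" "j < k" "k \<le> n" "p i > p j" "p j > p k"
  shows False
  using assms unfolding mem_Av_321_iff by blast

lemma Av_321_permutes: "p \<in> Av n [3, 2, 1] \<Longrightarrow> p permutes {1..n}"
  unfolding mem_Av_321_iff by blast

text \<open>Pigeonhole: fewer than \<open>m\<close> positions cannot carry all of the \<open>m\<close> smallest values. This supplies the
  missing entry of a 321 pattern in the arguments below.\<close>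

lemma small_value_outside:
  assumes p: "p permutes {1..n}" and S: "finite S" "card S < m" "m \<le> n"
  obtains k where "k \<in> {1..n}" "k \<notin> S" "p k \<le> m"
proof -
  have "card (inv p ` {1..m}) = m"
    by (subst card_image) (auto intro: inj_on_subset[OF permutes_inj[OF permutes_inv[OF p]]])
  then have "\<not> inv p ` {1..m} \<subseteq> S"
    using card_mono[OF S(1), of "inv p ` {1..m}"] S(2) by auto
  then obtain v where v: "v \<in> {1..m}" "inv p v \<notin> S" by blast
  then have "inv p v \<in> {1..n}" using S(3) permutes_in_image[OF permutes_inv[OF p]] by auto
  then show thesis using v that[of "inv p v"] permutes_inverses(1)[OF p] by simp
qed

lemma large_value_outside:
  assumes p: "p permutes {1..n}" and S: "finite S" "card S < n - m"
  obtains k where "k \<in> {1..n}" "k \<notin> S" "m < p k"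
proof -
  have "card (inv p ` {m<..n}) = n - m"
    by (subst card_image) (auto intro: inj_on_subset[OF permutes_inj[OF permutes_inv[OF p]]])
  then have "\<not> inv p ` {m<..n} \<subseteq> S"
    using card_mono[OF S(1), of "inv p ` {m<..n}"] S(2) by auto
  then obtain v where v: "v \<in> {m<..n}" "inv p v \<notin> S" by blast
  then have "v \<in> {1..n}" by auto
  then have "inv p v \<in> {1..n}" using permutes_in_image[OF permutes_inv[OF p]] by blast
  then show thesis using v that[of "inv p v"] permutes_inverses(1)[OF p] by simp
qed

text \<open>If two excedances \<open>i < j\<close> were inverted, then \<open>p j > j\<close> leaves too few positions up to \<open>j\<close> for the
  values below \<open>p j\<close>, so one of these values comes after \<open>j\<close> and completes a 321 pattern.\<close>

lemma Av_321_mono_exc: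
  assumes p: "p \<in> Av n [3, 2, 1]"
  shows "strict_mono_on (exc_pos n p) p"
proof (rule strict_mono_onI, rule ccontr)
  fix i j assume ij: "i \<in> exc_pos n p" "j \<in> exc_pos n p" "i < j" "\<not> p i < p j"
  note perm = Av_321_permutes[OF p]
  have "p i \<noteq> p j" using ij permutes_inj[OF perm] by (auto dest: injD)
  then have gt: "p j < p i" using ij by simp
  have b: "1 \<le> i" "j < p j" "p j \<le> n" "j \<le> n"
    using ij permutes_in_image[OF perm, of j] by (auto simp: exc_pos_def)
  obtain k where k: "k \<in> {1..n}" "k \<notin> {1..j} - {i, j}" "p k \<le> p j - 1"
  proof (rule small_value_outside[OF perm, of "{1..j} - {i, j}" "p j - 1"])
    \<comment> \<open>The positions \<open>i\<close> and \<open>j\<close> do not carry values below \<open>p j\<close>.\<close>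
    have "card ({1..j} - {i, j}) \<le> j - 2" using ij b by (subst card_Diff_subset) auto
    then show "card ({1..j} - {i, j}) < p j - 1" using b ij by linarith
  qed (use b in auto)
  have "k \<noteq> i" "k \<noteq> j" using k gt b by auto
  with k have "j < k" by auto
  moreover have "p k < p j" using k(3) b by linarith
  ultimately show False using Av_321_D[OF p, of i j k] ij b k gt by auto
qed

text \<open>The mirror image: if two non-excedances \<open>i < j\<close> were inverted, then \<open>p i \<le> i\<close> forces a value above \<open>p i\<close>
  to occur before \<open>i\<close>.\<close>

lemma Av_321_mono_non_exc:
  assumes p: "p \<in> Av n [3, 2, 1]"
  shows "strict_mono_on ({1..n} - exc_pos n p) p"
proof (rule strict_mono_onI, rule ccontr)
  fix i j assume ij: "i \<in> {1..n} - exc_pos n p" "j \<in> {1..n} - exc_pos n p" "i < j" "\<not> p i < p j"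
  note perm = Av_321_permutes[OF p]
  have "p i \<noteq> p j" using ij permutes_inj[OF perm] by (auto dest: injD)
  then have gt: "p j < p i" using ij by simp
  have b: "1 \<le> i" "p i \<le> i" "p j \<le> j" "j \<le> n"
    using ij by (auto simp: exc_pos_def)
  obtain k where k: "k \<in> {1..n}" "k \<notin> {i..n} - {i, j}" "p i < p k"
  proof (rule large_value_outside[OF perm, of "{i..n} - {i, j}" "p i"])
    have "card ({i..n} - {i, j}) = (n + 1 - i) - 2" using ij b by (subst card_Diff_subset) auto
    then show "card ({i..n} - {i, j}) < n - p i" using b ij by linarith
  qed (use b in auto)
  have "k \<noteq> i" "k \<noteq> j" using k gt b by auto
  with k have "k < i" by auto
  then show False using Av_321_D[OF p, of k i j] ij b k gt by auto
qed

lemma card_Int_atMost_less: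
  fixes B :: "nat set"
  assumes "u < v" "v \<in> B" "finite B"
  shows "card (B \<inter> {..u}) < card (B \<inter> {..v})"
proof (rule psubset_card_mono)
  have "v \<in> B \<inter> {..v}" "v \<notin> B \<inter> {..u}" using assms by auto
  moreover have "B \<inter> {..u} \<subseteq> B \<inter> {..v}" using assms by auto
  ultimately show "B \<inter> {..u} \<subset> B \<inter> {..v}" by blast
qed (use assms in simp)

text \<open>An increasing bijection preserves ranks; this is what pins it down, and it turns inequalities
  between values into inequalities between the counting functions of \<open>E\<close> and \<open>V\<close>.\<close>

lemma rank_preserved:
  fixes f :: "nat \<Rightarrow> nat"
  assumes "strict_mono_on A f" "f ` A = B" "x \<in> A"
  shows "card (B \<inter> {..f x}) = card (A \<inter> {..x})"
proof -
  have "B \<inter> {..f x} = f ` (A \<inter> {..x})"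
    using assms strict_mono_on_less_eq[OF assms(1)] by auto
  then show ?thesis
    using strict_mono_on_imp_inj_on[OF assms(1)] by (simp add: card_image inj_on_subset)
qed

lemma strict_mono_on_image_unique:
  fixes f g :: "nat \<Rightarrow> nat"
  assumes "finite A" "strict_mono_on A f" "strict_mono_on A g" "f ` A = g ` A" "x \<in> A"
  shows "f x = g x"
proof -
  have "card ((f ` A) \<inter> {..f x}) = card ((f ` A) \<inter> {..g x})"
    using rank_preserved[OF assms(2) refl assms(5)] rank_preserved[OF assms(3) refl assms(5)] assms(4) by simp
  moreover have "f x \<in> f ` A" "g x \<in> f ` A" using assms(4,5) by auto
  ultimately show ?thesis
    using card_Int_atMost_less[of "f x" "g x" "f ` A"] card_Int_atMost_less[of "g x" "f x" "f ` A"] assms(1)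
    by (cases "f x" "g x" rule: linorder_cases) simp_all
qed

lemma exc_pair_inj: "inj_on (exc_pair n) (Av n [3, 2, 1])"
proof (rule inj_onI, rule ext)
  fix p p' x assume p: "p \<in> Av n [3, 2, 1]" "p' \<in> Av n [3, 2, 1]" and eq: "exc_pair n p = exc_pair n p'"
  note perm = Av_321_permutes[OF p(1)] Av_321_permutes[OF p(2)]
  have E: "exc_pos n p = exc_pos n p'" and V: "p ` exc_pos n p = p' ` exc_pos n p"
    using eq by (auto simp: exc_pair_def)
  have W: "p ` ({1..n} - exc_pos n p) = p' ` ({1..n} - exc_pos n p)"
    using V permutes_image[OF perm(1)] permutes_image[OF perm(2)]
    by (simp add: image_set_diff permutes_inj[OF perm(1)] permutes_inj[OF perm(2)])
  show "p x = p' x"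
  proof (cases "x \<in> {1..n}")
    case False
    then show ?thesis using perm by (simp add: permutes_not_in)
  next
    case True
    show ?thesis
    proof (cases "x \<in> exc_pos n p")
      case True
      show ?thesis
        by (rule strict_mono_on_image_unique[OF _ Av_321_mono_exc[OF p(1)] _ V True])
           (use Av_321_mono_exc[OF p(2)] E finite_subset[OF exc_pos_subset] in auto)
    next
      case False
      with True have x: "x \<in> {1..n} - exc_pos n p" by simp
      show ?thesis
        by (rule strict_mono_on_image_unique[OF _ Av_321_mono_non_exc[OF p(1)] _ W x])
           (use Av_321_mono_non_exc[OF p(2)] E in auto)
    qed
  qed
qed

lemma exc_pair_mem:
  assumes p: "p permutes {1..n}"
  shows "exc_pair n p \<in> motzkin_pairs n 0"
proof -
  let ?E = "exc_pos n p"
  have inj: "inj_on p A" for A using permutes_inj[OF p] by (rule inj_on_subset) auto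
  have "p ` ?E \<subseteq> {1..n}" using exc_pos_subset permutes_in_image[OF p] by blast
  moreover have "card ((p ` ?E) \<inter> {..x}) \<le> card (?E \<inter> {..<x})" for x
  proof -
    have "(p ` ?E) \<inter> {..x} \<subseteq> p ` (?E \<inter> {..<x})" by (auto simp: exc_pos_def)
    then have "card ((p ` ?E) \<inter> {..x}) \<le> card (p ` (?E \<inter> {..<x}))" by (rule card_mono[rotated]) simp
    also have "\<dots> = card (?E \<inter> {..<x})" by (rule card_image[OF inj])
    finally show ?thesis .
  qed
  ultimately show ?thesis
    using exc_pos_subset[of n p] card_image[OF inj, of ?E] by (auto simp: exc_pair_def motzkin_pairs_def)
qed

text \<open>The height of the path after step \<open>k\<close> counts the arcs of \<open>p\<close> that cross from \<open>{1..k}\<close> upwards: the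
  excedances at positions up to \<open>k\<close> whose value is also at most \<open>k\<close> cancel against their values in \<open>V\<close>.\<close>

lemma crossing_number:
  assumes p: "p permutes {1..n}"
  shows "card ((p ` exc_pos n p) \<inter> {..k}) + card {i \<in> {1..k}. k < p i} = card (exc_pos n p \<inter> {..k})"
proof -
  let ?E = "exc_pos n p"
  have inj: "inj_on p A" for A using permutes_inj[OF p] by (rule inj_on_subset) auto
  have pn: "i \<le> n" if "i < p i" for i
    using that permutes_not_in[OF p, of i] by (cases "i \<in> {1..n}") auto
  have "?E \<inter> {..k} = {i \<in> ?E. p i \<le> k} \<union> {i \<in> {1..k}. k < p i}"
    using pn by (auto simp: exc_pos_def)
  then have "card (?E \<inter> {..k}) = card {i \<in> ?E. p i \<le> k} + card {i \<in> {1..k}. k < p i}"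
    by (simp add: finite_subset[OF exc_pos_subset] card_Un_disjoint disjoint_iff)
  also have "card {i \<in> ?E. p i \<le> k} = card (p ` {i \<in> ?E. p i \<le> k})" by (rule card_image[OF inj, symmetric])
  also have "p ` {i \<in> ?E. p i \<le> k} = (p ` ?E) \<inter> {..k}" by auto
  finally show ?thesis by simp
qed

text \<open>A point in neither set satisfies \<open>p k \<le> k \<le> inv p k\<close>, so only fixed points have to be separated. An arc
  crossing \<open>k\<close> upwards over a fixed point \<open>k\<close> is matched by one crossing downwards, and the two form a
  321 pattern with \<open>k\<close>; conversely at a double deficiency the arc into \<open>k\<close> from above forces an upward crossing.\<close>

lemma double_deficiency_iff:
  assumes p: "p \<in> Av n [3, 2, 1]" and k: "k \<in> {1..n}"
  shows "double_deficiency n p k \<longleftrightarrow> k \<notin> exc_pos n p \<and> k \<notin> p ` exc_pos n p \<and>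
     card ((p ` exc_pos n p) \<inter> {..k}) < card (exc_pos n p \<inter> {..k})"
proof -
  note perm = Av_321_permutes[OF p]
  have inj: "inj_on p A" for A using permutes_inj[OF perm] by (rule inj_on_subset) auto
  have ik: "inv p k \<in> {1..n}" using k permutes_in_image[OF permutes_inv[OF perm]] by blast
  have pi: "p (inv p k) = k" by (rule permutes_inverses(1)[OF perm])
  have V: "k \<in> p ` exc_pos n p \<longleftrightarrow> inv p k < k"
  proof
    assume "k \<in> p ` exc_pos n p"
    then obtain i where "k = p i" "i < p i" by (auto simp: exc_pos_def)
    then show "inv p k < k" using permutes_inverses(2)[OF perm] by simp
  next
    assume "inv p k < k"
    then have "inv p k \<in> exc_pos n p" using ik pi by (simp add: exc_pos_def)
    then show "k \<in> p ` exc_pos n p" using pi by (metis imageI)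
  qed
  have fixed: "inv p k = k \<longleftrightarrow> p k = k" using pi permutes_inverses(2)[OF perm] by metis
  have C: "card ((p ` exc_pos n p) \<inter> {..k}) < card (exc_pos n p \<inter> {..k}) \<longleftrightarrow> (\<exists>i\<in>{1..k}. k < p i)"
  proof -
    have "card ((p ` exc_pos n p) \<inter> {..k}) < card (exc_pos n p \<inter> {..k}) \<longleftrightarrow> 0 < card {i \<in> {1..k}. k < p i}"
      unfolding crossing_number[OF perm, of k, symmetric] by simp
    also have "\<dots> \<longleftrightarrow> (\<exists>i\<in>{1..k}. k < p i)" by (auto simp: card_gt_0_iff)
    finally show ?thesis .
  qed
  have cross: "\<exists>i\<in>{1..k}. k < p i" if j: "j \<in> {1..n}" "k < j" "p j \<le> k" for j
  proof (rule ccontr)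
    assume "\<not> ?thesis"
    then have le: "p i \<le> k" if "i \<in> insert j {1..k}" for i
      using that j by force
    moreover have "1 \<le> p i" if "i \<in> insert j {1..k}" for i
      using that j k permutes_in_image[OF perm, of i] by auto
    ultimately have "p ` insert j {1..k} \<subseteq> {1..k}"
      by (simp only: image_subset_iff atLeastAtMost_iff) blast
    then have "card (p ` insert j {1..k}) \<le> card {1..k}" by (intro card_mono) auto
    moreover have "card (p ` insert j {1..k}) = Suc k" using j by (subst card_image[OF inj]) auto
    ultimately show False by simp
  qed
  have not_fixed: "p k \<noteq> k" if i: "i \<in> {1..k}" "k < p i" for i
  proof
    assume pk: "p k = k"
    then have ik: "i < k" using i by (cases "i = k") auto
    obtain j where j: "j \<in> {1..n}" "j \<notin> {1..k} - {i}" "p j \<le> k"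
    proof (rule small_value_outside[OF perm, of "{1..k} - {i}" k])
      show "card ({1..k} - {i}) < k" using i by simp
    qed (use k in auto)
    then have "k < j" using i by (cases "j = i") auto
    moreover from this have "p j \<noteq> k" using pk permutes_inj[OF perm] by (metis injD less_irrefl)
    ultimately show False using Av_321_D[OF p, of i k j] i ik j pk by auto
  qed
  show ?thesis
  proof
    assume dd: "double_deficiency n p k"
    then have "p k < k" "k < inv p k" by (auto simp: double_deficiency_def)
    then show "k \<notin> exc_pos n p \<and> k \<notin> p ` exc_pos n p \<and> card ((p ` exc_pos n p) \<inter> {..k}) < card (exc_pos n p \<inter> {..k})"
      unfolding C V using cross[of "inv p k"] ik pi by (auto simp: exc_pos_def)
  next
    assume a: "k \<notin> exc_pos n p \<and> k \<notin> p ` exc_pos n p \<and> card ((p ` exc_pos n p) \<inter> {..k}) < card (exc_pos n p \<inter> {..k})"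
    then have "p k \<noteq> k" unfolding C using not_fixed by blast
    moreover have "p k \<le> k" using a k by (auto simp: exc_pos_def)
    moreover have "k \<le> inv p k" using a V by simp
    ultimately show "double_deficiency n p k"
      using k fixed by (auto simp: double_deficiency_def)
  qed
qed

lemma num_double_deficiencies_eq:
  assumes p: "p \<in> Av n [3, 2, 1]"
  shows "num_double_deficiencies n p = marked_levels n (exc_pair n p)"
proof -
  have "{k. double_deficiency n p k} = {k \<in> {1..n}. double_deficiency n p k}"
    by (auto simp: double_deficiency_def)
  also have "\<dots> = {k \<in> {1..n}. k \<notin> exc_pos n p \<and> k \<notin> p ` exc_pos n p \<and>
     card ((p ` exc_pos n p) \<inter> {..k}) < card (exc_pos n p \<inter> {..k})}"
    using double_deficiency_iff[OF p] by blast
  finally show ?thesis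
    by (simp add: num_double_deficiencies_def marked_levels_def exc_pair_def)
qed

lemma obtain_increasing_bij:
  fixes A B :: "nat set"
  assumes "finite A" "finite B" "card A = card B"
  obtains f where "strict_mono_on A f" "f ` A = B"
proof -
  obtain g where g: "bij_betw g {..<card A} A" "strict_mono_on {..<card A} g"
    by (rule ex_bij_betw_strict_mono_card[OF assms(1)])
  obtain h where h: "bij_betw h {..<card B} B" "strict_mono_on {..<card B} h"
    by (rule ex_bij_betw_strict_mono_card[OF assms(2)])
  let ?r = "inv_into {..<card A} g"
  have r: "?r x \<in> {..<card A}" "g (?r x) = x" if "x \<in> A" for x
    using inv_into_into[of x g "{..<card A}"] f_inv_into_f[of x g "{..<card A}"] g(1) that
    by (simp_all add: bij_betw_def)
  have mono: "strict_mono_on A (h \<circ> ?r)"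
  proof (rule strict_mono_onI)
    fix x y assume xy: "x \<in> A" "y \<in> A" "x < y"
    then have "?r x < ?r y" using strict_mono_on_less[OF g(2) r(1)[OF xy(1)] r(1)[OF xy(2)]] r(2) by simp
    then show "(h \<circ> ?r) x < (h \<circ> ?r) y"
      using strict_mono_onD[OF h(2)] r(1) xy assms(3) by simp
  qed
  have "?r ` A = {..<card A}" using g(1) by (metis bij_betw_imp_surj_on bij_betw_inv_into)
  then have "(h \<circ> ?r) ` A = B"
    using h(1) assms(3) unfolding image_comp[symmetric] by (simp only: bij_betw_def)
  with mono show thesis by (rule that)
qed

text \<open>The inverse map: send \<open>E\<close> to \<open>V\<close> and the complement of \<open>E\<close> to that of \<open>V\<close> increasingly. Comparing ranks, the
  path condition says that the first map increases every point and the second increases none. A union of two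
  increasing sequences has no decreasing triple.\<close>

lemma exc_pair_surj:
  assumes EV: "(E, V) \<in> motzkin_pairs n 0"
  obtains p where "p \<in> Av n [3, 2, 1]" "exc_pair n p = (E, V)"
proof -
  have E: "E \<subseteq> {1..n}" and V: "V \<subseteq> {1..n}" and c: "card E = card V"
    using EV by (simp_all add: motzkin_pairs_def)
  have bal: "card (V \<inter> {..x}) \<le> card (E \<inter> {..<x})" if "x \<in> {1..n}" for x
    using EV that by (simp add: motzkin_pairs_def)
  have fin: "finite E" "finite V" using finite_subset[OF E] finite_subset[OF V] by auto
  obtain f where f: "strict_mono_on E f" "f ` E = V"
    using obtain_increasing_bij[OF fin c] by blast
  have "card ({1..n} - E) = card ({1..n} - V)" using E V c fin by (simp add: card_Diff_subset)
  then obtain g where g: "strict_mono_on ({1..n} - E) g" "g ` ({1..n} - E) = {1..n} - V"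
    using obtain_increasing_bij[of "{1..n} - E" "{1..n} - V"] by auto
  have fgt: "i < f i" if i: "i \<in> E" for i
  proof (rule ccontr)
    assume "\<not> i < f i"
    then have le: "f i \<le> i" by simp
    have "f i \<in> {1..n}" using f(2) V i by auto
    then have "card (V \<inter> {..f i}) \<le> card (E \<inter> {..<f i})" by (rule bal)
    also have "\<dots> \<le> card (E \<inter> {..i} - {i})" using le fin by (intro card_mono) auto
    also have "\<dots> < card (E \<inter> {..i})" using i fin by (intro card_Diff1_less) auto
    also have "\<dots> = card (V \<inter> {..f i})" using rank_preserved[OF f i] by simp
    finally show False by simp
  qed
  have gle: "g i \<le> i" if i: "i \<in> {1..n} - E" for i
  proof (rule ccontr)
    assume "\<not> g i \<le> i"
    then have gt: "i < g i" by simp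
    have gi: "g i \<in> {1..n} - V" using g(2) i by auto
    have compl: "card (({1..n} - A) \<inter> {..i}) = i - card (A \<inter> {..i})" if "A \<subseteq> {1..n}" for A
    proof -
      have "({1..n} - A) \<inter> {..i} = {1..i} - (A \<inter> {..i})" using i by auto
      moreover have "A \<inter> {..i} \<subseteq> {1..i}" using that by auto
      moreover from this have "finite (A \<inter> {..i})" by (rule finite_subset) simp
      ultimately show ?thesis by (simp add: card_Diff_subset)
    qed
    have "card (V \<inter> {..i}) \<le> card (E \<inter> {..<i})" using bal i by simp
    also have "\<dots> \<le> card (E \<inter> {..i})" using fin by (intro card_mono) auto
    finally have "card (({1..n} - E) \<inter> {..i}) \<le> card (({1..n} - V) \<inter> {..i})"
      unfolding compl[OF E] compl[OF V] by (rule diff_le_mono2)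
    also have "\<dots> < card (({1..n} - V) \<inter> {..g i})" by (rule card_Int_atMost_less[OF gt gi]) simp
    also have "\<dots> = card (({1..n} - E) \<inter> {..i})" by (rule rank_preserved[OF g i])
    finally show False by simp
  qed
  define p where "p i = (if i \<in> E then f i else if i \<in> {1..n} then g i else i)" for i
  have pE: "p ` E = V" using f(2) by (simp add: p_def)
  have pC: "p ` ({1..n} - E) = {1..n} - V" unfolding g(2)[symmetric] by (rule image_cong) (auto simp: p_def)
  have "p ` {1..n} = p ` E \<union> p ` ({1..n} - E)" using E by blast
  then have img: "p ` {1..n} = {1..n}" using pE pC V by auto
  then have "inj_on p {1..n}" by (simp add: eq_card_imp_inj_on)
  with img have perm: "p permutes {1..n}"
    using E by (intro bij_imp_permutes) (auto simp: bij_betw_def p_def)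
  have mono: "p i < p j" if "i < j" "i \<in> {1..n}" "j \<in> {1..n}" "i \<in> E \<longleftrightarrow> j \<in> E" for i j
    using that strict_mono_onD[OF f(1)] strict_mono_onD[OF g(1)] by (auto simp: p_def)
  have "p \<in> Av n [3, 2, 1]"
    unfolding mem_Av_321_iff
  proof (intro conjI perm notI, elim exE conjE)
    fix i j k assume *: "1 \<le> i" "i < j" "j < k" "k \<le> n" "p j < p i" "p k < p j"
    consider "i \<in> E \<longleftrightarrow> j \<in> E" | "j \<in> E \<longleftrightarrow> k \<in> E" | "i \<in> E \<longleftrightarrow> k \<in> E" by blast
    then show False
      using mono[of i j] mono[of j k] mono[of i k] * by cases auto
  qed
  moreover have "exc_pos n p = E"
  proof (intro equalityI subsetI)
    fix i assume "i \<in> exc_pos n p"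
    then have i: "i \<in> {1..n}" "i < p i" by (simp_all add: exc_pos_def)
    show "i \<in> E"
    proof (rule ccontr)
      assume "i \<notin> E"
      with i gle[of i] show False by (simp add: p_def)
    qed
  next
    fix i assume "i \<in> E"
    then show "i \<in> exc_pos n p" using E fgt[of i] by (auto simp: exc_pos_def p_def)
  qed
  then have "exc_pair n p = (E, V)" by (simp add: exc_pair_def pE)
  ultimately show thesis by (rule that)
qed

lemma exc_pair_bij: "bij_betw (exc_pair n) (Av n [3, 2, 1]) (motzkin_pairs n 0)"
  unfolding bij_betw_def
proof (intro conjI exc_pair_inj equalityI subsetI)
  fix P assume "P \<in> exc_pair n ` Av n [3, 2, 1]"
  then show "P \<in> motzkin_pairs n 0" using exc_pair_mem Av_321_permutes by blast
next
  fix P assume "P \<in> motzkin_pairs n 0"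
  then obtain p where "p \<in> Av n [3, 2, 1]" "exc_pair n p = P" by (cases P) (blast elim: exc_pair_surj)
  then show "P \<in> exc_pair n ` Av n [3, 2, 1]" by blast
qed

lemma card_double_deficiencies:
  "card {p \<in> Av n [3, 2, 1]. num_double_deficiencies n p = k} = card {P \<in> motzkin_pairs n 0. marked_levels n P = k}"
proof (rule bij_betw_same_card)
  show "bij_betw (exc_pair n) {p \<in> Av n [3, 2, 1]. num_double_deficiencies n p = k}
     {P \<in> motzkin_pairs n 0. marked_levels n P = k}"
    by (rule bij_betw_Collect[OF exc_pair_bij]) (simp add: num_double_deficiencies_eq)
qed

section \<open>Counting the paths by their marked level steps\<close>

definition path_gf :: "nat \<Rightarrow> nat \<Rightarrow> real \<Rightarrow> real" where
  "path_gf n h q = (\<Sum>P\<in>motzkin_pairs n h. q ^ marked_levels n P)"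

lemma motzkin_pairs_subset: "motzkin_pairs n h \<subseteq> Pow {1..n} \<times> Pow {1..n}"
  by (auto simp: motzkin_pairs_def)

lemma finite_motzkin_pairs [simp]: "finite (motzkin_pairs n h)"
  by (rule finite_subset[OF motzkin_pairs_subset]) auto

lemma Int_atMost_id: "A \<subseteq> {1..n} \<Longrightarrow> n \<le> x \<Longrightarrow> A \<inter> {..x} = (A :: nat set)"
  by fastforce

lemma Int_lessThan_id: "A \<subseteq> {1..n} \<Longrightarrow> n < x \<Longrightarrow> A \<inter> {..<x} = (A :: nat set)"
  by fastforce

lemma motzkin_pairs_0: "motzkin_pairs 0 h = (if h = 0 then {({}, {})} else {})"
  by (auto simp: motzkin_pairs_def)

text \<open>Adding a last step. The booleans \<open>e\<close> and \<open>v\<close> say whether the new point joins \<open>E\<close> and \<open>V\<close>; the path had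
  height \<open>g\<close> before that step.\<close>

lemma motzkin_pairs_extend:
  assumes E: "E \<subseteq> {1..n}" and V: "V \<subseteq> {1..n}"
  shows "(if e then insert (Suc n) E else E, if v then insert (Suc n) V else V) \<in> motzkin_pairs (Suc n) h
     \<longleftrightarrow> (\<exists>g. (E, V) \<in> motzkin_pairs n g \<and> g + of_bool e = h + of_bool v \<and> of_bool v \<le> g)"
    (is "(?E, ?V) \<in> _ \<longleftrightarrow> _")
proof -
  have fin: "finite E" "finite V" using finite_subset[OF E] finite_subset[OF V] by simp_all
  have new: "Suc n \<notin> E" "Suc n \<notin> V" using E V by auto
  have sub: "?E \<subseteq> {1..Suc n}" "?V \<subseteq> {1..Suc n}" using E V by auto
  have cE: "card ?E = card E + of_bool e" and cV: "card ?V = card V + of_bool v"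
    using fin new by auto
  have old: "?V \<inter> {..x} = V \<inter> {..x}" "?E \<inter> {..<x} = E \<inter> {..<x}" if "x \<in> {1..n}" for x
    using that by auto
  have last: "?V \<inter> {..Suc n} = ?V" "?E \<inter> {..<Suc n} = E"
    using Int_atMost_id[OF sub(2)] Int_lessThan_id[OF E] by simp_all
  have "(\<forall>x\<in>{1..Suc n}. card (?V \<inter> {..x}) \<le> card (?E \<inter> {..<x})) \<longleftrightarrow>
    (\<forall>x\<in>{1..n}. card (?V \<inter> {..x}) \<le> card (?E \<inter> {..<x})) \<and> card (?V \<inter> {..Suc n}) \<le> card (?E \<inter> {..<Suc n})"
    unfolding atLeastAtMostSuc_conv[OF le_add1[of 1 n, unfolded plus_1_eq_Suc]] by blast
  also have "\<dots> \<longleftrightarrow> (\<forall>x\<in>{1..n}. card (V \<inter> {..x}) \<le> card (E \<inter> {..<x})) \<and> card V + of_bool v \<le> card E"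
    unfolding last cV by (simp only: old cong: ball_cong)
  finally have c: "(\<forall>x\<in>{1..Suc n}. card (?V \<inter> {..x}) \<le> card (?E \<inter> {..<x})) \<longleftrightarrow> \<dots>" .
  have "(?E, ?V) \<in> motzkin_pairs (Suc n) h \<longleftrightarrow> card E + of_bool e = card V + of_bool v + h \<and>
     (\<forall>x\<in>{1..n}. card (V \<inter> {..x}) \<le> card (E \<inter> {..<x})) \<and> card V + of_bool v \<le> card E"
    unfolding motzkin_pairs_def mem_Collect_eq prod.case c cE cV using sub by blast
  also have "\<dots> \<longleftrightarrow> (\<exists>g. (E, V) \<in> motzkin_pairs n g \<and> g + of_bool e = h + of_bool v \<and> of_bool v \<le> g)"
    (is "?l \<longleftrightarrow> ?r")
  proof
    assume ?l
    then show ?r using E V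
      by (intro exI[of _ "card E - card V"]) (auto simp: motzkin_pairs_def)
  next
    assume ?r
    then show ?l by (auto simp: motzkin_pairs_def)
  qed
  finally show ?thesis .
qed

lemma marked_levels_extend:
  assumes P: "(E, V) \<in> motzkin_pairs n g"
  shows "marked_levels (Suc n) (if e then insert (Suc n) E else E, if v then insert (Suc n) V else V)
     = marked_levels n (E, V) + of_bool (\<not> e \<and> \<not> v \<and> g > 0)" (is "marked_levels _ (?E, ?V) = _")
proof -
  have E: "E \<subseteq> {1..n}" and V: "V \<subseteq> {1..n}" and g: "card E = card V + g"
    using P by (auto simp: motzkin_pairs_def)
  have old: "?V \<inter> {..x} = V \<inter> {..x}" "?E \<inter> {..x} = E \<inter> {..x}" "x \<in> ?E \<longleftrightarrow> x \<in> E" "x \<in> ?V \<longleftrightarrow> x \<in> V"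
    if "x \<in> {1..n}" for x
    using that by auto
  have last: "V \<inter> {..Suc n} = V" "E \<inter> {..Suc n} = E"
    using Int_atMost_id[OF V] Int_atMost_id[OF E] by simp_all
  have "{k \<in> {1..Suc n}. k \<notin> ?E \<and> k \<notin> ?V \<and> card (?V \<inter> {..k}) < card (?E \<inter> {..k})}
     = {k \<in> {1..n}. k \<notin> ?E \<and> k \<notin> ?V \<and> card (?V \<inter> {..k}) < card (?E \<inter> {..k})} \<union>
       (if \<not> e \<and> \<not> v \<and> g > 0 then {Suc n} else {})"
    using E V g by (auto simp: le_Suc_eq last)
  also have "{k \<in> {1..n}. k \<notin> ?E \<and> k \<notin> ?V \<and> card (?V \<inter> {..k}) < card (?E \<inter> {..k})} =
     {k \<in> {1..n}. k \<notin> E \<and> k \<notin> V \<and> card (V \<inter> {..k}) < card (E \<inter> {..k})}"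
    by (rule Collect_cong) (simp only: old cong: conj_cong)
  finally show ?thesis
    unfolding marked_levels_def prod.case by (auto simp: card_Un_disjoint)
qed

text \<open>Recursion on the last step. No up step ends at height 0; there is no level step of the colour
  ``both'' there, and the colour ``neither'' carries weight 1 instead of \<open>q\<close>.\<close>

lemma path_gf_Suc:
  "path_gf (Suc n) h q = (if h = 0 then 0 else path_gf n (h - 1) q) + path_gf n (Suc h) q
     + (if h = 0 then 1 else 1 + q) * path_gf n h q"
proof -
  define ext :: "bool \<Rightarrow> bool \<Rightarrow> nat set \<times> nat set \<Rightarrow> nat set \<times> nat set" where
    "ext e v = (\<lambda>(E, V). (if e then insert (Suc n) E else E, if v then insert (Suc n) V else V))" for e v
  define B where "B = Pow {1..n} \<times> Pow {1..n :: nat}"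
  define S where "S e v = {P \<in> B. ext e v P \<in> motzkin_pairs (Suc n) h}" for e v
  have inj: "inj_on (ext e v) B" for e v
  proof (rule inj_onI)
    fix P P' assume *: "P \<in> B" "P' \<in> B" "ext e v P = ext e v P'"
    obtain E V E' V' where [simp]: "P = (E, V)" "P' = (E', V')" by fastforce
    have n: "Suc n \<notin> E" "Suc n \<notin> V" "Suc n \<notin> E'" "Suc n \<notin> V'" using * by (auto simp: B_def)
    have "(if e then insert (Suc n) E else E) - {Suc n} = (if e then insert (Suc n) E' else E') - {Suc n}"
      "(if v then insert (Suc n) V else V) - {Suc n} = (if v then insert (Suc n) V' else V') - {Suc n}"
      using * by (simp_all add: ext_def)
    then show "P = P'" using n by (auto split: if_splits)
  qed
  have finB: "finite B" by (auto simp: B_def)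
  have part: "motzkin_pairs (Suc n) h = ext True False ` S True False \<union> ext False True ` S False True
      \<union> ext True True ` S True True \<union> ext False False ` S False False" (is "_ = ?R")
  proof
    show "motzkin_pairs (Suc n) h \<subseteq> ?R"
    proof
      fix P assume P: "P \<in> motzkin_pairs (Suc n) h"
      obtain E V where PE: "P = (E, V)" by fastforce
      define Q where "Q = (E - {Suc n}, V - {Suc n})"
      have "E \<subseteq> {1..Suc n}" "V \<subseteq> {1..Suc n}" using P PE by (auto simp: motzkin_pairs_def)
      then have "E - {Suc n} \<subseteq> {1..n}" "V - {Suc n} \<subseteq> {1..n}"
        by (auto simp: subset_iff le_Suc_eq)
      then have "Q \<in> B" by (auto simp: Q_def B_def)
      moreover have "ext (Suc n \<in> E) (Suc n \<in> V) Q = P" by (auto simp: ext_def Q_def PE)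
      ultimately have "P \<in> ext (Suc n \<in> E) (Suc n \<in> V) ` S (Suc n \<in> E) (Suc n \<in> V)"
        unfolding S_def using P by (auto intro!: rev_image_eqI[of Q])
      then show "P \<in> ?R" by (cases "Suc n \<in> E"; cases "Suc n \<in> V") auto
    qed
  qed (auto simp: S_def)
  have mark: "(Suc n \<in> fst P) = e \<and> (Suc n \<in> snd P) = v" if "P \<in> ext e v ` S e v" for P e v
    using that by (auto simp: S_def B_def ext_def split: if_splits)
  have disj: "ext e v ` S e v \<inter> ext e' v' ` S e' v' = {}" if "(e, v) \<noteq> (e', v')" for e v e' v'
  proof (rule ccontr)
    assume "\<not> ?thesis"
    then obtain P where "P \<in> ext e v ` S e v" "P \<in> ext e' v' ` S e' v'" by auto
    from mark[OF this(1)] mark[OF this(2)] that show False by auto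
  qed
  have finS: "finite (S e v)" for e v using finB by (auto simp: S_def)
  have ext_mem: "P \<in> S e v \<longleftrightarrow> (\<exists>g. P \<in> motzkin_pairs n g \<and> g + of_bool e = h + of_bool v \<and> of_bool v \<le> g)" for P e v
  proof -
    have B: "P \<in> B" if "P \<in> motzkin_pairs n g" for g
      using that motzkin_pairs_subset unfolding B_def by blast
    obtain E V where PE: "P = (E, V)" by fastforce
    show ?thesis
    proof (cases "P \<in> B")
      case True
      then have "E \<subseteq> {1..n}" "V \<subseteq> {1..n}" by (auto simp: B_def PE)
      from motzkin_pairs_extend[OF this] show ?thesis
        using True by (simp add: S_def ext_def PE)
    next
      case False
      then show ?thesis using B by (auto simp: S_def)
    qed
  qed
  have S: "S True False = (if h = 0 then {} else motzkin_pairs n (h - 1))" "S False True = motzkin_pairs n (Suc h)"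
     "S True True = (if h = 0 then {} else motzkin_pairs n h)" "S False False = motzkin_pairs n h"
    unfolding set_eq_iff ext_mem by (cases h; auto simp: Suc_le_eq)+
  have sum_ext: "(\<Sum>P\<in>ext e v ` S e v. q ^ marked_levels (Suc n) P) =
      q ^ of_bool (\<not> e \<and> \<not> v \<and> h > 0) * (\<Sum>P\<in>S e v. q ^ marked_levels n P)" for e v
  proof -
    have "(\<Sum>P\<in>ext e v ` S e v. q ^ marked_levels (Suc n) P) = (\<Sum>P\<in>S e v. q ^ marked_levels (Suc n) (ext e v P))"
      by (subst sum.reindex) (auto intro: inj_on_subset[OF inj] simp: S_def)
    also have "\<dots> = (\<Sum>P\<in>S e v. q ^ of_bool (\<not> e \<and> \<not> v \<and> h > 0) * q ^ marked_levels n P)"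
    proof (rule sum.cong[OF refl])
      fix P assume "P \<in> S e v"
      then obtain g where g: "P \<in> motzkin_pairs n g" "g + of_bool e = h + of_bool v"
        unfolding ext_mem by blast
      obtain E V where PE: "P = (E, V)" by fastforce
      have "marked_levels (Suc n) (ext e v P) = marked_levels n P + of_bool (\<not> e \<and> \<not> v \<and> g > 0)"
        using marked_levels_extend[of E V n g e v] g by (simp add: ext_def PE)
      also have "(\<not> e \<and> \<not> v \<and> g > 0) = (\<not> e \<and> \<not> v \<and> h > 0)" using g(2) by auto
      finally show "q ^ marked_levels (Suc n) (ext e v P) = q ^ of_bool (\<not> e \<and> \<not> v \<and> h > 0) * q ^ marked_levels n P"
        by (simp add: power_add)
    qed
    finally show ?thesis by (simp add: sum_distrib_left)
  qed
  have "path_gf (Suc n) h q = (\<Sum>P\<in>ext True False ` S True False. q ^ marked_levels (Suc n) P) +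
     (\<Sum>P\<in>ext False True ` S False True. q ^ marked_levels (Suc n) P) +
     (\<Sum>P\<in>ext True True ` S True True. q ^ marked_levels (Suc n) P) +
     (\<Sum>P\<in>ext False False ` S False False. q ^ marked_levels (Suc n) P)"
    unfolding path_gf_def part using finS disj
    by (subst sum.union_disjoint; (simp add: Int_Un_distrib2)?)+
  then show ?thesis
    unfolding sum_ext unfolding S by (cases h) (auto simp: path_gf_def algebra_simps)
qed

lemma path_gf_0: "path_gf 0 h q = of_bool (h = 0)"
  by (auto simp: path_gf_def motzkin_pairs_0 marked_levels_def)

unbundle no vec_syntax
unbundle fps_syntax

definition step_poly :: "real \<Rightarrow> real poly" where "step_poly q = [:1, 1 + q, 1:]"
abbreviation step_fps :: "real \<Rightarrow> real fps" where "step_fps q \<equiv> fps_of_poly (step_poly q)"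
text \<open>Kernel method: away from height 0, the recursion is multiplication by \<open>step_poly\<close>. The factor
  \<open>(1 - X\<^sup>2) / (1 + q X)\<close> is chosen so that the boundary recursion holds as well.\<close>

definition kernel_fps :: "real \<Rightarrow> nat \<Rightarrow> real fps" where
  "kernel_fps q n = step_fps q ^ n * (1 - fps_X ^ 2) * inverse (1 + fps_const q * fps_X)"

lemma step_fps_eq: "step_fps q = 1 + fps_const (1 + q) * fps_X + fps_X ^ 2"
  by (simp add: step_poly_def fps_of_poly_pCons algebra_simps power2_eq_square)

lemma kernel_fps_mult: "kernel_fps q n * (1 + fps_const q * fps_X) = step_fps q ^ n * (1 - fps_X ^ 2)"
proof -
  have "inverse (1 + fps_const q * fps_X) * (1 + fps_const q * fps_X) = 1"
    by (rule inverse_mult_eq_1) simp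
  then show ?thesis by (simp add: kernel_fps_def mult.assoc)
qed

lemma step_power_palindromic: "i \<le> 2 * n \<Longrightarrow> step_fps q ^ n $ (2 * n - i) = step_fps q ^ n $ i"
proof -
  assume i: "i \<le> 2 * n"
  have d: "degree (step_poly q ^ n) = 2 * n" by (simp add: step_poly_def degree_power_eq)
  have r: "reflect_poly (step_poly q ^ n) = step_poly q ^ n"
    by (simp add: reflect_poly_power) (simp add: step_poly_def reflect_poly_def)
  have "coeff (step_poly q ^ n) i = coeff (step_poly q ^ n) (2 * n - i)"
    using i by (subst r[symmetric], subst coeff_reflect_poly) (simp add: d)
  then show ?thesis by (simp flip: fps_of_poly_power)
qed

text \<open>This is the defect between the recursion inside and at height 0. Multiplying by
  \<open>1 + q X\<close> leaves \<open>step_poly ^ n * (1 - X\<^sup>2)\<close>, whose coefficient at \<open>n + 1\<close> is a difference of two coefficients that lie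
  symmetrically around the centre \<open>n\<close>.\<close>

lemma kernel_boundary: "kernel_fps q n $ Suc n + q * kernel_fps q n $ n = 0"
proof -
  have "kernel_fps q n $ Suc n + q * kernel_fps q n $ n = (kernel_fps q n * (1 + fps_const q * fps_X)) $ Suc n"
  proof -
    have "kernel_fps q n * (1 + fps_const q * fps_X) = kernel_fps q n + fps_const q * (kernel_fps q n * fps_X)"
      by (simp add: distrib_left mult_ac)
    then show ?thesis by simp
  qed
  also have "\<dots> = step_fps q ^ n $ Suc n - (if n = 0 then 0 else step_fps q ^ n $ (n - 1))"
    unfolding kernel_fps_mult by (simp add: right_diff_distrib fps_X_power_mult_right_nth)
  also have "\<dots> = 0"
    using step_power_palindromic[of "n - 1" n q] by (cases n) auto
  finally show ?thesis .
qed

lemma kernel_fps_Suc: "kernel_fps q (Suc n) $ i = kernel_fps q n $ i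
   + (if i = 0 then 0 else (1 + q) * kernel_fps q n $ (i - 1)) + (if i < 2 then 0 else kernel_fps q n $ (i - 2))"
proof -
  have "kernel_fps q (Suc n) = kernel_fps q n + fps_const (1 + q) * (kernel_fps q n * fps_X) + kernel_fps q n * fps_X ^ 2"
    by (simp add: kernel_fps_def step_fps_eq algebra_simps del: fps_const_add)
  then show ?thesis by (simp add: fps_X_power_mult_right_nth)
qed

lemma path_gf_kernel: "path_gf n h q = (if h \<le> n then kernel_fps q n $ (n - h) else 0)"
proof (induction n arbitrary: h)
  case 0
  then show ?case by (simp add: path_gf_0 kernel_fps_def)
next
  case (Suc n)
  show ?case
  proof (cases "h = 0")
    case True
    have "kernel_fps q (Suc n) $ Suc n = kernel_fps q n $ Suc n + (1 + q) * kernel_fps q n $ n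
       + (if n = 0 then 0 else kernel_fps q n $ (n - 1))"
      by (simp add: kernel_fps_Suc)
    then show ?thesis
      using True kernel_boundary[of q n] by (simp add: path_gf_Suc Suc algebra_simps)
  next
    case False
    then obtain g where h: "h = Suc g" by (cases h) auto
    have p: "path_gf (Suc n) h q = path_gf n g q + path_gf n (Suc h) q + (1 + q) * path_gf n h q"
      by (simp add: path_gf_Suc h)
    consider "h \<le> n" | "n = g" | "n < g" unfolding h by linarith
    then show ?thesis
    proof cases
      case 1
      then obtain d where d: "n = h + d" using le_Suc_ex by blast
      have "n - g = Suc d" "n - h = d" "Suc n - h = Suc d" "n - Suc h = d - 1" "Suc h \<le> n \<longleftrightarrow> 1 \<le> d"
        "g \<le> n" "h \<le> n" "h \<le> Suc n"
        using d h by auto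
      then show ?thesis unfolding p Suc by (cases d) (simp_all add: kernel_fps_Suc)
    next
      case 2
      then have "g \<le> n" "\<not> h \<le> n" "\<not> Suc h \<le> n" "h \<le> Suc n" "n - g = 0" "Suc n - h = 0"
        using h by auto
      then show ?thesis unfolding p Suc by (simp add: kernel_fps_Suc)
    next
      case 3
      then have "\<not> g \<le> n" "\<not> h \<le> n" "\<not> Suc h \<le> n" "\<not> h \<le> Suc n"
        using h by auto
      then show ?thesis unfolding p Suc by simp
    qed
  qed
qed

lemma fps_linear_power_nth: "(1 + fps_const c * fps_X) ^ m $ k = of_nat (m choose k) * (c :: 'a :: comm_ring_1) ^ k"
proof -
  have "(1 + fps_const c * fps_X) ^ m = (\<Sum>i\<le>m. fps_const (of_nat (m choose i) * c ^ i) * fps_X ^ i)"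
    unfolding add.commute[of 1] binomial_ring
    by (intro sum.cong) (simp_all add: power_mult_distrib fps_const_power fps_of_nat[symmetric] flip: fps_const_mult)
  also have "\<dots> $ k = (\<Sum>i\<le>m. if k = i then of_nat (m choose i) * c ^ i else 0)"
    unfolding fps_sum_nth by (intro sum.cong) (simp_all add: fps_X_power_nth)
  also have "\<dots> = of_nat (m choose k) * c ^ k"
    by (simp add: binomial_eq_0)
  finally show ?thesis .
qed

text \<open>Lagrange inversion in disguise. With \<open>f\<close> the step polynomial, \<open>R = 1 / (1 + q X)\<close> and \<open>G = f ^ (n + 1) * R\<close>,
  the identity \<open>f - X f' = 1 - X\<^sup>2\<close> shows that the two sides differ by the \<open>n\<close>-th coefficient of
  \<open>n G - X G'\<close>, which vanishes for every series \<open>G\<close>. The gain is that the negative factor \<open>1 - X\<^sup>2\<close> has disappeared.\<close>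

lemma path_gf_lagrange:
  "real (n + 1) * path_gf n 0 q = (step_fps q ^ (n + 1) * inverse (1 + fps_const q * fps_X) ^ 2) $ n"
proof -
  define c where "c = fps_const q"
  define R where "R = inverse (1 + c * fps_X)"
  define f where "f = step_fps q"
  define N where "N = (of_nat n :: real fps)"
  have R: "R * (1 + c * fps_X) = 1" unfolding R_def by (rule inverse_mult_eq_1) (simp add: c_def)
  have f: "f = 1 + (1 + c) * fps_X + fps_X ^ 2"
    by (simp add: f_def step_fps_eq c_def flip: fps_const_add)
  have dR: "fps_deriv R = - c * R ^ 2"
    unfolding R_def by (subst fps_inverse_deriv) (simp_all add: c_def)
  have df: "fps_deriv f = (1 + c) + 2 * fps_X"
    unfolding f by (simp add: c_def fps_deriv_power power2_eq_square)
  define G where "G = f ^ (n + 1) * R"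
  have dG: "fps_deriv G = (N + 1) * f ^ n * ((1 + c) + 2 * fps_X) * R - f ^ (n + 1) * c * R ^ 2"
    unfolding G_def fps_deriv_mult dR fps_deriv_power df
    by (simp add: N_def fps_of_nat[symmetric] algebra_simps flip: fps_const_add)
  have R2: "R = R ^ 2 * (1 + c * fps_X)" using R by (simp add: power2_eq_square mult.assoc)
  have G2: "f ^ (n + 1) * R = f ^ (n + 1) * R ^ 2 * (1 + c * fps_X)"
    by (subst R2) (simp only: mult.assoc)
  have "(N + 1) * (f ^ n * (1 - fps_X ^ 2) * R) - f ^ (n + 1) * R ^ 2 - (N * G - fps_X * fps_deriv G)
     = (N + 1) * f ^ n * R * ((1 - fps_X ^ 2) - f + fps_X * ((1 + c) + 2 * fps_X))
       + (f ^ (n + 1) * R - f ^ (n + 1) * R ^ 2 * (1 + c * fps_X))"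
    unfolding dG unfolding G_def by (simp add: algebra_simps)
  also have "(1 - fps_X ^ 2) - f + fps_X * ((1 + c) + 2 * fps_X) = 0"
    unfolding f by (simp add: algebra_simps power2_eq_square)
  also have "f ^ (n + 1) * R - f ^ (n + 1) * R ^ 2 * (1 + c * fps_X) = 0" using G2 by simp
  finally have "(N + 1) * (f ^ n * (1 - fps_X ^ 2) * R) - f ^ (n + 1) * R ^ 2 = N * G - fps_X * fps_deriv G"
    by simp
  then have "((N + 1) * (f ^ n * (1 - fps_X ^ 2) * R)) $ n - (f ^ (n + 1) * R ^ 2) $ n = (N * G - fps_X * fps_deriv G) $ n"
    by (metis fps_sub_nth)
  also have "\<dots> = 0" by (cases n) (simp_all add: N_def fps_of_nat[symmetric])
  also have "(N + 1) = fps_const (real (n + 1))" by (simp add: N_def fps_of_nat[symmetric] fps_const_add flip: fps_const_1_eq_1)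
  also have "(fps_const (real (n + 1)) * (f ^ n * (1 - fps_X ^ 2) * R)) $ n = real (n + 1) * path_gf n 0 q"
    by (simp add: path_gf_kernel kernel_fps_def f_def R_def c_def)
  finally show ?thesis by (simp add: f_def R_def c_def)
qed

text \<open>This is \<open>n + 1\<close> times the number of paths with \<open>k\<close> marked steps, see \<open>card_marked_levels\<close>. The separate
  constant is the term \<open>j = n\<close>, in which the second binomial coefficient has upper index \<open>- 1\<close>.\<close>

definition path_coeff :: "nat \<Rightarrow> nat \<Rightarrow> nat" where
  "path_coeff n k = (\<Sum>j<n. (n + 1 choose j) * (n - 1 - j choose k) * (j choose (n - j - k)))
     + (if k = 0 then n + 1 else 0)"

text \<open>Expand the power of \<open>X (1 + X) + (1 + q X)\<close> by the binomial theorem. For \<open>j < n\<close> the factor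
  \<open>(1 + q X)\<^sup>2\<close> in the denominator cancels; the term \<open>j = n\<close> contributes the constant \<open>n + 1\<close>, and the last one
  starts beyond degree \<open>n\<close>.\<close>

lemma path_gf_expand: "real (n + 1) * path_gf n 0 q = (\<Sum>k\<le>n. real (path_coeff n k) * q ^ k)"
proof -
  define l where "l = 1 + fps_const q * fps_X"
  define R where "R = inverse l"
  have R: "l * R = 1" unfolding R_def by (rule inverse_mult_eq_1') (simp add: l_def)
  have f: "step_fps q = fps_X * (1 + fps_X) + l"
    by (simp add: step_fps_eq l_def algebra_simps power2_eq_square flip: fps_const_add)
  define t where "t j = real (n + 1 choose j) * ((fps_X * (1 + fps_X)) ^ j * l ^ (n + 1 - j) * R ^ 2) $ n" for j
  have "real (n + 1) * path_gf n 0 q = (step_fps q ^ (n + 1) * R ^ 2) $ n"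
    unfolding path_gf_lagrange R_def l_def ..
  also have "\<dots> = (\<Sum>j\<le>n + 1. t j)"
    unfolding f binomial_ring sum_distrib_right fps_sum_nth t_def
    by (intro sum.cong) (simp_all add: fps_of_nat[symmetric] mult.assoc)
  also have "\<dots> = (\<Sum>j<n. t j) + (t n + t (n + 1))"
    by (simp add: lessThan_Suc_atMost[symmetric])
  also have "t (n + 1) = 0"
    by (simp add: t_def power_mult_distrib mult.assoc fps_X_power_mult_nth del: power_Suc)
  also have "t n = real (n + 1)"
  proof -
    have "l * R ^ 2 = R" by (simp add: power2_eq_square mult.assoc[symmetric] R)
    then have "((fps_X * (1 + fps_X)) ^ n * l ^ (n + 1 - n) * R ^ 2) $ n = (fps_X ^ n * ((1 + fps_X) ^ n * R)) $ n"
      by (simp add: power_mult_distrib mult.assoc)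
    also have "\<dots> = 1"
      by (simp add: fps_X_power_mult_nth R_def l_def fps_nth_power_0)
    finally show ?thesis by (simp add: t_def)
  qed
  also have "(\<Sum>j<n. t j) = (\<Sum>j<n. \<Sum>k\<le>n. real ((n + 1 choose j) * (n - 1 - j choose k) * (j choose (n - j - k))) * q ^ k)"
  proof (rule sum.cong[OF refl])
    fix j assume "j \<in> {..<n}"
    then have j: "j < n" by simp
    have pow: "(1 + fps_X :: real fps) ^ j $ i = real (j choose i)" for i
      using fps_linear_power_nth[of "1 :: real" j i] by simp
    have "l ^ (n + 1 - j) = l ^ (n - 1 - j) * l ^ 2"
      unfolding power_add[symmetric] using j by (intro arg_cong[of _ _ "(^) l"]) simp
    then have "l ^ (n + 1 - j) * R ^ 2 = l ^ (n - 1 - j) * (l * R) ^ 2"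
      by (simp only: power_mult_distrib mult.assoc)
    then have "(fps_X * (1 + fps_X)) ^ j * l ^ (n + 1 - j) * R ^ 2 = fps_X ^ j * (1 + fps_X) ^ j * l ^ (n - 1 - j)"
      by (simp only: R power_mult_distrib mult.assoc power_one mult_1_right)
    then have "t j = real (n + 1 choose j) * (fps_X ^ j * (l ^ (n - 1 - j) * (1 + fps_X) ^ j)) $ n"
      unfolding t_def by (simp only: mult_ac)
    also have "(fps_X ^ j * (l ^ (n - 1 - j) * (1 + fps_X) ^ j)) $ n = (l ^ (n - 1 - j) * (1 + fps_X) ^ j) $ (n - j)"
      using j by (simp add: fps_X_power_mult_nth)
    also have "\<dots> = (\<Sum>k\<le>n - j. real (n - 1 - j choose k) * q ^ k * real (j choose (n - j - k)))"
      unfolding fps_mult_nth l_def fps_linear_power_nth pow by (simp add: atLeast0AtMost)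
    also have "\<dots> = (\<Sum>k\<le>n. real (n - 1 - j choose k) * q ^ k * real (j choose (n - j - k)))"
      using j by (intro sum.mono_neutral_left) (auto simp: binomial_eq_0)
    finally show "t j = (\<Sum>k\<le>n. real ((n + 1 choose j) * (n - 1 - j choose k) * (j choose (n - j - k))) * q ^ k)"
      by (simp add: sum_distrib_left mult_ac)
  qed
  also have "\<dots> + (real (n + 1) + 0) = (\<Sum>k\<le>n. (\<Sum>j<n. real ((n + 1 choose j) * (n - 1 - j choose k) * (j choose (n - j - k)))) * q ^ k)
      + (\<Sum>k\<le>n. (if k = 0 then real (n + 1) else 0) * q ^ k)"
    by (subst sum.swap) (simp add: sum_distrib_right if_distrib[of "\<lambda>x. x * _"] cong: if_cong)
  also have "\<dots> = (\<Sum>k\<le>n. real (path_coeff n k) * q ^ k)"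
    unfolding sum.distrib[symmetric] path_coeff_def by (intro sum.cong) (auto simp: algebra_simps)
  finally show ?thesis .
qed

lemma path_coeff_eq_0: "n \<le> k \<Longrightarrow> 0 < k \<Longrightarrow> path_coeff n k = 0"
  by (auto simp: path_coeff_def binomial_eq_0)

text \<open>Both sides are coefficients of polynomials in \<open>q\<close> that agree for all real \<open>q\<close>.\<close>

lemma card_marked_levels:
  "(n + 1) * card {P \<in> motzkin_pairs n 0. marked_levels n P = k} = path_coeff n k"
proof -
  define c where "c k = card {P \<in> motzkin_pairs n 0. marked_levels n P = k}" for k
  have le: "marked_levels n P \<le> n" for P
  proof -
    have "marked_levels n P \<le> card {1..n}"
      unfolding marked_levels_def by (cases P) (auto intro!: card_mono simp del: card_atLeastAtMost)
    then show ?thesis by simp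
  qed
  have gf: "path_gf n 0 q = (\<Sum>k\<le>n. real (c k) * q ^ k)" for q
  proof -
    have "path_gf n 0 q = (\<Sum>k\<le>n. \<Sum>P\<in>{P \<in> motzkin_pairs n 0. marked_levels n P = k}. q ^ marked_levels n P)"
      unfolding path_gf_def by (rule sum.group[symmetric]) (auto simp: le)
    also have "\<dots> = (\<Sum>k\<le>n. real (c k) * q ^ k)"
      by (intro sum.cong) (auto simp: c_def)
    finally show ?thesis .
  qed
  define A where "A = (\<Sum>k\<le>n. monom (real ((n + 1) * c k)) k)"
  define B where "B = (\<Sum>k\<le>n. monom (real (path_coeff n k)) k)"
  have "poly A q = poly B q" for q
    using path_gf_expand[of n q] unfolding gf
    by (simp add: A_def B_def poly_sum poly_monom sum_distrib_left algebra_simps)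
  then have "A = B" by (simp add: poly_eq_poly_eq_iff[symmetric] ext)
  then have AB: "coeff A k = coeff B k" by simp
  have "c k = 0" if "k > n"
  proof -
    have "{P \<in> motzkin_pairs n 0. marked_levels n P = k} = {}"
      using that le not_less by auto
    then show ?thesis by (simp add: c_def)
  qed
  then show ?thesis
  proof (cases "k \<le> n")
    case True
    then have "coeff A k = real ((n + 1) * c k)" "coeff B k = real (path_coeff n k)"
      by (simp_all add: A_def B_def coeff_sum)
    then show ?thesis using AB unfolding c_def by (simp only: of_nat_eq_iff)
  next
    case False
    then show ?thesis using path_coeff_eq_0[of n k] \<open>k > n \<Longrightarrow> c k = 0\<close> by (simp add: c_def)
  qed
qed

section \<open>Law, mean and variance\<close>

text \<open>Absorb the factor \<open>k\<close> into the first binomial coefficient and convolve.\<close>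

lemma vandermonde_moment1:
  assumes "r \<ge> 1"
  shows "(\<Sum>k\<le>r. k * (m choose k) * (j choose (r - k))) = m * (m + j - 1 choose (r - 1))"
proof -
  obtain s where r: "r = Suc s" using assms by (cases r) auto
  show ?thesis
  proof (cases m)
    case (Suc l)
    have "(\<Sum>k\<le>r. k * (m choose k) * (j choose (r - k))) = (\<Sum>k\<le>s. Suc k * (Suc l choose Suc k) * (j choose (s - k)))"
      unfolding r Suc by (subst sum.atMost_Suc_shift) simp
    also have "\<dots> = (\<Sum>k\<le>s. Suc l * ((l choose k) * (j choose (s - k))))"
      unfolding Suc_times_binomial by (simp only: mult.assoc)
    also have "\<dots> = Suc l * (l + j choose s)"
      unfolding sum_distrib_left[symmetric] vandermonde ..
    finally show ?thesis by (simp add: Suc r)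
  qed (auto intro!: sum.neutral)
qed

lemma vandermonde_moment2:
  assumes "r \<ge> 2 \<or> m \<le> 1"
  shows "(\<Sum>k\<le>r. k * (k - 1) * (m choose k) * (j choose (r - k))) = m * (m - 1) * (m + j - 2 choose (r - 2))"
proof (cases "m \<le> 1")
  case True
  have "k * (k - 1) * (m choose k) = 0" for k using True by (cases "k \<le> 1") (auto simp: binomial_eq_0)
  then show ?thesis using True by (cases m) auto
next
  case False
  with assms have r: "r \<ge> 1" "r - 1 \<ge> 1" by auto
  have t: "k * (k - 1) * (m choose k) = m * ((k - 1) * (m - 1 choose (k - 1)))" for k
  proof (cases "k = 0 \<or> m = 0")
    case False
    then obtain a b where ab: "k = Suc a" "m = Suc b" by (metis not0_implies_Suc)
    have "k * (k - 1) * (m choose k) = a * (Suc a * (Suc b choose Suc a))"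
      unfolding ab by (simp only: diff_Suc_1 mult_ac)
    also have "\<dots> = m * ((k - 1) * (m - 1 choose (k - 1)))"
      unfolding Suc_times_binomial ab by (simp only: diff_Suc_1 mult_ac)
    finally show ?thesis .
  qed (auto simp: binomial_eq_0)
  have "(\<Sum>k\<le>r. k * (k - 1) * (m choose k) * (j choose (r - k)))
      = m * (\<Sum>k\<le>r. (k - 1) * (m - 1 choose (k - 1)) * (j choose (r - k)))"
    unfolding t sum_distrib_left by (simp only: mult.assoc)
  also have "(\<Sum>k\<le>r. (k - 1) * (m - 1 choose (k - 1)) * (j choose (r - k)))
      = (\<Sum>k\<le>r - 1. k * (m - 1 choose k) * (j choose (r - 1 - k)))"
    using r(1) by (cases r) (simp_all add: sum.atMost_Suc_shift del: sum.atMost_Suc)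
  also have "\<dots> = (m - 1) * (m - 1 + j - 1 choose (r - 1 - 1))"
    by (rule vandermonde_moment1[OF r(2)])
  also have "m - 1 + j - 1 = m + j - 2" using False by simp
  finally show ?thesis by (simp add: mult_ac numeral_2_eq_2)
qed

text \<open>The hypothesis on \<open>g\<close> removes the exceptional constant in \<open>path_coeff n 0\<close>.\<close>

lemma path_coeff_moment:
  assumes g: "g 0 = 0"
  shows "(\<Sum>k\<le>n. g k * path_coeff n k)
     = (\<Sum>j<n. (n + 1 choose j) * (\<Sum>k\<le>n - j. g k * (n - 1 - j choose k) * (j choose (n - j - k))))"
proof -
  have "(\<Sum>k\<le>n. g k * path_coeff n k) = (\<Sum>k\<le>n. \<Sum>j<n. (n + 1 choose j) * (g k * (n - 1 - j choose k) * (j choose (n - j - k))))"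
    by (intro sum.cong) (auto simp: path_coeff_def g sum_distrib_left algebra_simps)
  also have "\<dots> = (\<Sum>j<n. (n + 1 choose j) * (\<Sum>k\<le>n. g k * (n - 1 - j choose k) * (j choose (n - j - k))))"
    by (subst sum.swap) (simp add: sum_distrib_left)
  also have "\<dots> = (\<Sum>j<n. (n + 1 choose j) * (\<Sum>k\<le>n - j. g k * (n - 1 - j choose k) * (j choose (n - j - k))))"
  proof (rule sum.cong[OF refl])
    fix j assume "j \<in> {..<n}"
    then have "(\<Sum>k\<le>n - j. g k * (n - 1 - j choose k) * (j choose (n - j - k))) = (\<Sum>k\<le>n. g k * (n - 1 - j choose k) * (j choose (n - j - k)))"
      by (intro sum.mono_neutral_left) (auto simp: binomial_eq_0)
    then show "(n + 1 choose j) * (\<Sum>k\<le>n. g k * (n - 1 - j choose k) * (j choose (n - j - k)))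
       = (n + 1 choose j) * (\<Sum>k\<le>n - j. g k * (n - 1 - j choose k) * (j choose (n - j - k)))" by simp
  qed
  finally show ?thesis .
qed

text \<open>The exceptional constant \<open>n + 1\<close> in \<open>path_coeff n 0\<close> is exactly the term \<open>j = n\<close> that completes the outer
  Vandermonde convolution.\<close>

lemma path_coeff_sum: "(\<Sum>k\<le>n. path_coeff n k) = (2 * n choose n)"
proof (cases n)
  case (Suc m)
  have "(\<Sum>k\<le>n. path_coeff n k) = path_coeff n 0 + (\<Sum>k\<le>n. of_bool (k \<noteq> 0) * path_coeff n k)"
    by (simp add: Suc sum.atMost_Suc_shift del: sum.atMost_Suc)
  also have "path_coeff n 0 = (n + 1) + (\<Sum>j<n. (n + 1 choose j) * (j choose (n - j)))"
    by (simp add: path_coeff_def)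
  also have "(\<Sum>k\<le>n. of_bool (k \<noteq> 0) * path_coeff n k)
     = (\<Sum>j<n. (n + 1 choose j) * (\<Sum>k\<le>n - j. of_bool (k \<noteq> 0) * (n - 1 - j choose k) * (j choose (n - j - k))))"
    by (rule path_coeff_moment) simp
  finally have "(\<Sum>k\<le>n. path_coeff n k) = (n + 1) + (\<Sum>j<n. (n + 1 choose j) * ((j choose (n - j)) +
      (\<Sum>k\<le>n - j. of_bool (k \<noteq> 0) * (n - 1 - j choose k) * (j choose (n - j - k)))))"
    by (simp add: distrib_left sum.distrib)
  also have "(\<Sum>j<n. (n + 1 choose j) * ((j choose (n - j)) +
      (\<Sum>k\<le>n - j. of_bool (k \<noteq> 0) * (n - 1 - j choose k) * (j choose (n - j - k)))))
    = (\<Sum>j<n. (n + 1 choose j) * (n - 1 choose (n - j)))"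
  proof (intro sum.cong refl arg_cong2[of _ _ _ _ "(*)"])
    fix j assume "j \<in> {..<n}"
    then obtain d where d: "n - j = Suc d" "n - 1 - j + j = n - 1" by (cases "n - j") auto
    have "(j choose (n - j)) + (\<Sum>k\<le>n - j. of_bool (k \<noteq> 0) * (n - 1 - j choose k) * (j choose (n - j - k)))
      = (\<Sum>k\<le>n - j. (n - 1 - j choose k) * (j choose (n - j - k)))"
      unfolding d(1) by (simp add: sum.atMost_Suc_shift del: sum.atMost_Suc)
    also have "\<dots> = (n - 1 choose (n - j))" unfolding vandermonde d(2) ..
    finally show "(j choose (n - j)) + (\<Sum>k\<le>n - j. of_bool (k \<noteq> 0) * (n - 1 - j choose k) * (j choose (n - j - k)))
      = (n - 1 choose (n - j))" .
  qed
  also have "(n + 1) + (\<Sum>j<n. (n + 1 choose j) * (n - 1 choose (n - j))) = (\<Sum>j\<le>n. (n + 1 choose j) * (n - 1 choose (n - j)))"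
    by (simp add: lessThan_Suc_atMost[symmetric])
  also have "\<dots> = (n + 1 + (n - 1) choose n)" by (rule vandermonde)
  also have "n + 1 + (n - 1) = 2 * n" using Suc by simp
  finally show ?thesis .
qed (simp add: path_coeff_def)

text \<open>Two nested Vandermonde convolutions. Writing \<open>n = p + 3\<close> avoids truncated subtraction.\<close>

lemma path_coeff_moment1: "(\<Sum>k\<le>p + 3. k * path_coeff (p + 3) k) = (p + 1) * (2 * p + 4 choose (p + 1))"
proof -
  have "(\<Sum>k\<le>p + 3. k * path_coeff (p + 3) k) = (\<Sum>j<p + 3. (p + 4 choose j) *
     (\<Sum>k\<le>p + 3 - j. k * (p + 2 - j choose k) * (j choose (p + 3 - j - k))))"
    using path_coeff_moment[of "\<lambda>k. k" "p + 3"] by (simp add: numeral_eq_Suc)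
  also have "\<dots> = (\<Sum>j<p + 3. (p + 4 choose j) * ((p + 2 - j) * (p + 1 choose (p + 2 - j))))"
  proof (intro sum.cong refl arg_cong2[of _ _ _ _ "(*)"])
    fix j assume j: "j \<in> {..<p + 3}"
    have "(\<Sum>k\<le>p + 3 - j. k * (p + 2 - j choose k) * (j choose (p + 3 - j - k)))
       = (p + 2 - j) * (p + 2 - j + j - 1 choose (p + 3 - j - 1))"
      using j by (intro vandermonde_moment1) auto
    moreover have "p + 2 - j + j - 1 = p + 1" "p + 3 - j - 1 = p + 2 - j" using j by auto
    ultimately show "(\<Sum>k\<le>p + 3 - j. k * (p + 2 - j choose k) * (j choose (p + 3 - j - k))) = (p + 2 - j) * (p + 1 choose (p + 2 - j))" by (simp only:)
  qed
  also have "\<dots> = (\<Sum>i\<le>p + 2. i * (p + 1 choose i) * (p + 4 choose (p + 2 - i)))"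
    by (rule sum.reindex_bij_witness[of _ "\<lambda>i. p + 2 - i" "\<lambda>j. p + 2 - j"]) auto
  also have "\<dots> = (p + 1) * (p + 1 + (p + 4) - 1 choose (p + 2 - 1))"
    by (rule vandermonde_moment1) simp
  also have "p + 1 + (p + 4) - 1 = 2 * p + 4" by simp
  also have "p + 2 - 1 = p + 1" by simp
  finally show ?thesis .
qed

lemma path_coeff_moment2: "(\<Sum>k\<le>p + 3. k * (k - 1) * path_coeff (p + 3) k)
    = p * ((p - 1) * (2 * p + 2 choose (p - 1)) + 2 * (2 * p + 3 choose p))"
proof -
  have "(\<Sum>k\<le>p + 3. k * (k - 1) * path_coeff (p + 3) k) = (\<Sum>j<p + 3. (p + 4 choose j) *
     (\<Sum>k\<le>p + 3 - j. k * (k - 1) * (p + 2 - j choose k) * (j choose (p + 3 - j - k))))"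
    using path_coeff_moment[of "\<lambda>k. k * (k - 1)" "p + 3"] by (simp add: numeral_eq_Suc)
  also have "\<dots> = (\<Sum>j<p + 3. (p + 4 choose j) * ((p + 2 - j) * (p + 1 - j) * (p choose (p + 1 - j))))"
  proof (intro sum.cong refl arg_cong2[of _ _ _ _ "(*)"])
    fix j assume j: "j \<in> {..<p + 3}"
    have "(\<Sum>k\<le>p + 3 - j. k * (k - 1) * (p + 2 - j choose k) * (j choose (p + 3 - j - k)))
       = (p + 2 - j) * (p + 2 - j - 1) * (p + 2 - j + j - 2 choose (p + 3 - j - 2))"
      using j by (intro vandermonde_moment2) auto
    moreover have "p + 2 - j + j - 2 = p" "p + 3 - j - 2 = p + 1 - j" "p + 2 - j - 1 = p + 1 - j" using j by auto
    ultimately show "(\<Sum>k\<le>p + 3 - j. k * (k - 1) * (p + 2 - j choose k) * (j choose (p + 3 - j - k)))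
       = (p + 2 - j) * (p + 1 - j) * (p choose (p + 1 - j))" by (simp only:)
  qed
  also have "\<dots> = (\<Sum>j\<le>p + 1. (p + 4 choose j) * ((p + 2 - j) * (p + 1 - j) * (p choose (p + 1 - j))))"
    by (rule sum.mono_neutral_right) auto
  also have "\<dots> = (\<Sum>i\<le>p + 1. (i + 1) * i * (p choose i) * (p + 4 choose (p + 1 - i)))"
    by (rule sum.reindex_bij_witness[of _ "\<lambda>i. p + 1 - i" "\<lambda>j. p + 1 - j"]) (auto simp: Suc_diff_le)
  also have "\<dots> = (\<Sum>i\<le>p + 1. i * (i - 1) * (p choose i) * (p + 4 choose (p + 1 - i)))
      + 2 * (\<Sum>i\<le>p + 1. i * (p choose i) * (p + 4 choose (p + 1 - i)))"
    unfolding sum_distrib_left sum.distrib[symmetric]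
  proof (rule sum.cong[OF refl])
    fix i show "(i + 1) * i * (p choose i) * (p + 4 choose (p + 1 - i)) = i * (i - 1) * (p choose i) * (p + 4 choose (p + 1 - i))
      + 2 * (i * (p choose i) * (p + 4 choose (p + 1 - i)))" by (cases i) (simp_all add: algebra_simps)
  qed
  also have "(\<Sum>i\<le>p + 1. i * (i - 1) * (p choose i) * (p + 4 choose (p + 1 - i)))
     = p * (p - 1) * (p + (p + 4) - 2 choose (p + 1 - 2))"
    by (rule vandermonde_moment2) auto
  also have "(\<Sum>i\<le>p + 1. i * (p choose i) * (p + 4 choose (p + 1 - i))) = p * (p + (p + 4) - 1 choose (p + 1 - 1))"
    by (rule vandermonde_moment1) auto
  also have "p + (p + 4) - 2 = 2 * p + 2" by simp
  also have "p + (p + 4) - 1 = 2 * p + 3" by simp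
  also have "p + 1 - 2 = p - 1" by simp
  also have "p + 1 - 1 = p" by simp
  finally show ?thesis by (simp only: distrib_left mult_ac)
qed

lemma pmf_double_deficiency_law:
  "pmf (double_deficiency_law n) k = real (path_coeff n k) / real (2 * n choose n)"
proof -
  let ?A = "Av n [3, 2, 1]"
  define c where "c k = card {p \<in> ?A. num_double_deficiencies n p = k}" for k
  have c: "(n + 1) * c k = path_coeff n k" for k
    by (simp only: c_def card_double_deficiencies card_marked_levels)
  have le: "num_double_deficiencies n p \<le> n" for p
  proof -
    have "card {k. double_deficiency n p k} \<le> card {1..n}"
      by (intro card_mono) (auto simp: double_deficiency_def)
    then show ?thesis by (simp add: num_double_deficiencies_def)
  qed
  have "card ?A = (\<Sum>k\<le>n. c k)"
    unfolding c_def card_eq_sum by (rule sum.group[symmetric]) (auto simp: finite_Av le)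
  then have "(n + 1) * card ?A = (2 * n choose n)"
    by (simp only: sum_distrib_left c path_coeff_sum)
  then have tot: "real (2 * n choose n) = real (n + 1) * real (card ?A)" by (metis of_nat_mult)
  have "pmf (double_deficiency_law n) k = measure (pmf_of_set ?A) (num_double_deficiencies n -` {k})"
    by (simp add: double_deficiency_law_def pmf_map)
  also have "\<dots> = real (card (?A \<inter> num_double_deficiencies n -` {k})) / real (card ?A)"
    by (rule measure_pmf_of_set[OF Av_321_nonempty finite_Av])
  also have "?A \<inter> num_double_deficiencies n -` {k} = {p \<in> ?A. num_double_deficiencies n p = k}" by auto
  also have "real (card \<dots>) / real (card ?A) = (real (n + 1) * real (c k)) / (real (n + 1) * real (card ?A))"
    by (simp add: c_def)
  also have "real (n + 1) * real (c k) = real (path_coeff n k)" using c[of k] by (metis of_nat_mult)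
  finally show ?thesis unfolding tot .
qed

text \<open>The summand \<open>j = n - 1 - k\<close> is positive for \<open>k \<le> n - 2\<close>.\<close>

lemma path_coeff_pos_iff: "n \<ge> 2 \<Longrightarrow> path_coeff n k > 0 \<longleftrightarrow> k \<le> n - 2"
proof
  assume n: "n \<ge> 2" and k: "k \<le> n - 2"
  have "0 < (n + 1 choose (n - 1 - k)) * (n - 1 - (n - 1 - k) choose k) * (n - 1 - k choose (n - (n - 1 - k) - k))"
    using n k by (simp add: zero_less_binomial) arith
  also have "\<dots> \<le> (\<Sum>j<n. (n + 1 choose j) * (n - 1 - j choose k) * (j choose (n - j - k)))"
    using n by (intro member_le_sum) auto
  finally show "path_coeff n k > 0" by (simp add: path_coeff_def)
next
  assume n: "n \<ge> 2" and pos: "path_coeff n k > 0"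
  show "k \<le> n - 2"
  proof (rule ccontr)
    assume "\<not> k \<le> n - 2"
    then have k: "k \<ge> n - 1" "k > 0" using n by auto
    have "(n + 1 choose j) * (n - 1 - j choose k) * (j choose (n - j - k)) = 0" if "j < n" for j
      using k n that by (cases "j = 0"; cases "k = n - 1") (auto simp: binomial_eq_0)
    then have "path_coeff n k = 0" using k by (simp add: path_coeff_def)
    with pos show False by simp
  qed
qed

lemma set_pmf_double_deficiency_law: "n \<ge> 2 \<Longrightarrow> set_pmf (double_deficiency_law n) = {0..n - 2}"
proof -
  assume n: "n \<ge> 2"
  have "pmf (double_deficiency_law n) k \<noteq> 0 \<longleftrightarrow> k \<le> n - 2" for k
    using path_coeff_pos_iff[OF n, of k] by (simp add: pmf_double_deficiency_law)
  then show "set_pmf (double_deficiency_law n) = {0..n - 2}"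
    by (simp only: set_pmf_eq atLeastAtMost_iff set_eq_iff mem_Collect_eq le0 simp_thms)
qed

lemma expectation_double_deficiency_law:
  assumes "n \<ge> 2"
  shows "measure_pmf.expectation (double_deficiency_law n) f
     = (\<Sum>k\<le>n. f k * real (path_coeff n k)) / real (2 * n choose n)"
proof -
  have "measure_pmf.expectation (double_deficiency_law n) f = (\<Sum>k\<le>n. pmf (double_deficiency_law n) k *\<^sub>R f k)"
  proof (rule integral_measure_pmf)
    fix a assume "a \<in> set_pmf (double_deficiency_law n)"
    then have "a \<le> n - 2" unfolding set_pmf_double_deficiency_law[OF assms] by simp
    then show "a \<in> {..n}" by simp
  qed simp
  also have "\<dots> = (\<Sum>k\<le>n. f k * real (path_coeff n k) / real (2 * n choose n))"
    unfolding pmf_double_deficiency_law real_scaleR_def by (simp only: times_divide_eq_left times_divide_eq_right mult.commute)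
  finally show ?thesis unfolding sum_divide_distrib .
qed

lemma binomial_add_fact: "real (a + b choose a) = fact (a + b) / (fact a * fact b)"
  using binomial_fact[of a "a + b", where 'a = real] by (simp only: le_add1 diff_add_inverse)

text \<open>All binomial coefficients in the first two moments as rational multiples of one quantity \<open>X\<close>, so
  that the moment formulas become identities of rational functions.\<close>

lemma central_binomial_ratios:
  fixes p :: nat and X :: real
  defines "(X :: real) \<equiv> fact (2 * p + 2) / (fact p * fact (p + 3))"
  shows "real (2 * p + 6 choose (p + 3)) = 4 * (2 * p + 5) * (2 * p + 3) / (p + 1) * X"
    and "real (2 * p + 4 choose (p + 1)) = (2 * p + 4) * (2 * p + 3) / (p + 1) * X"
    and "real (2 * p + 3 choose p) = (2 * p + 3) * X"
    and "real p * real (2 * p + 2 choose (p - 1)) = real p * p * X"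
proof -
  have step: "fact m = (real k + 1) * fact k" if "m = Suc k" for m k
    unfolding that fact_Suc by (simp only: of_nat_Suc add.commute of_nat_fact)
  define F G H P :: real where "F = fact (2 * p + 2)" and "G = fact p" and "H = fact (p + 3)" and "P = real p"
  have f: "fact (2 * p + 6) = (2 * P + 6) * ((2 * P + 5) * ((2 * P + 4) * ((2 * P + 3) * F)))"
     "fact (2 * p + 4) = (2 * P + 4) * ((2 * P + 3) * F)"
     "fact (2 * p + 3) = (2 * P + 3) * F"
     "fact (p + 1) = (P + 1) * G"
     "H = (P + 3) * ((P + 2) * ((P + 1) * G))"
  proof -
    have fs: "fact (2 * p + 6) = (real (2 * p + 5) + 1) * fact (2 * p + 5)"
      "fact (2 * p + 5) = (real (2 * p + 4) + 1) * fact (2 * p + 4)"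
      "fact (2 * p + 4) = (real (2 * p + 3) + 1) * fact (2 * p + 3)"
      "fact (2 * p + 3) = (real (2 * p + 2) + 1) * fact (2 * p + 2)"
      "fact (p + 3) = (real (p + 2) + 1) * fact (p + 2)"
      "fact (p + 2) = (real (p + 1) + 1) * fact (p + 1)"
      "fact (p + 1) = (real p + 1) * fact p"
      by (rule step, simp)+
    have cs: "real (2 * p + 5) + 1 = 2 * P + 6" "real (2 * p + 4) + 1 = 2 * P + 5"
      "real (2 * p + 3) + 1 = 2 * P + 4" "real (2 * p + 2) + 1 = 2 * P + 3"
      "real (p + 2) + 1 = P + 3" "real (p + 1) + 1 = P + 2" "real p + 1 = P + 1"
      by (simp_all add: P_def)
    note fs = fs[unfolded cs, folded F_def G_def H_def]
    show "fact (p + 1) = (P + 1) * G" "fact (2 * p + 3) = (2 * P + 3) * F" by (fact fs)+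
    then show "fact (2 * p + 4) = (2 * P + 4) * ((2 * P + 3) * F)" "H = (P + 3) * ((P + 2) * ((P + 1) * G))"
      using fs by (simp_all only:)
    then show "fact (2 * p + 6) = (2 * P + 6) * ((2 * P + 5) * ((2 * P + 4) * ((2 * P + 3) * F)))"
      using fs(1,2) by (simp only:)
  qed
  have pos: "P \<ge> 0" "F > 0" "G > 0" "H > 0" by (simp_all add: F_def G_def H_def P_def)
  have X: "X = F / (G * H)" unfolding X_def F_def G_def H_def ..
  have e: "p + 3 + (p + 3) = 2 * p + 6" "p + 1 + (p + 3) = 2 * p + 4" "p + (p + 3) = 2 * p + 3"
    "p = Suc q \<Longrightarrow> q + (p + 3) = 2 * p + 2" for q
    by simp_all
  have "real (2 * p + 6 choose (p + 3)) = fact (2 * p + 6) / (H * H)"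
    using binomial_add_fact[of "p + 3" "p + 3"] unfolding H_def e(1) .
  also have "\<dots> = 4 * (2 * P + 5) * (2 * P + 3) / (P + 1) * X"
    unfolding f(1) X using pos by (subst (1) f(5)) (simp add: divide_simps, simp add: algebra_simps)
  finally show "real (2 * p + 6 choose (p + 3)) = 4 * (2 * p + 5) * (2 * p + 3) / (p + 1) * X"
    by (simp add: P_def add.commute)
  have "real (2 * p + 4 choose (p + 1)) = fact (2 * p + 4) / (fact (p + 1) * H)"
    using binomial_add_fact[of "p + 1" "p + 3"] unfolding H_def e(2) .
  then show "real (2 * p + 4 choose (p + 1)) = (2 * p + 4) * (2 * p + 3) / (p + 1) * X"
    unfolding f(2,4) X by (simp add: P_def add.commute mult.assoc)
  have "real (2 * p + 3 choose p) = fact (2 * p + 3) / (G * H)"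
    using binomial_add_fact[of p "p + 3"] unfolding G_def H_def e(3) .
  then show "real (2 * p + 3 choose p) = (2 * p + 3) * X"
    unfolding f(3) X by (simp add: P_def add.commute)
  show "real p * real (2 * p + 2 choose (p - 1)) = real p * p * X"
  proof (cases p)
    case (Suc q)
    have "real (2 * p + 2 choose (p - 1)) = F / (fact q * H)"
      using binomial_add_fact[of q "p + 3"] e(4)[OF Suc] Suc unfolding F_def H_def by (simp only: diff_Suc_1)
    also have "F / (fact q * H) = P * (F / (P * fact q * H))"
      using Suc by (simp add: P_def del: of_nat_Suc)
    also have "P * fact q = G"
      using step[OF Suc] Suc unfolding G_def P_def by (simp only: of_nat_Suc add.commute)
    finally show ?thesis unfolding X[symmetric] P_def by (simp only: mult.assoc)
  qed simp
qed

lemma double_deficiency_moments: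
  assumes n: "n \<ge> 2"
  shows "measure_pmf.expectation (double_deficiency_law n) real
              = (real n - 1) * (real n - 2) / (2 * (2 * real n - 1))" (is ?mean)
    and "measure_pmf.variance (double_deficiency_law n) real
              = (real n + 1) * (real n - 2) * (3 * real n ^ 2 - 8 * real n + 3)
                  / (2 * (2 * real n - 1) ^ 2 * (2 * real n - 3))" (is ?var)
proof -
  let ?L = "double_deficiency_law n"
  have fin: "finite (set_pmf ?L)" using set_pmf_double_deficiency_law[OF n] by simp
  have int: "integrable (measure_pmf ?L) f" for f :: "nat \<Rightarrow> real" by (rule integrable_measure_pmf_finite[OF fin])
  have var: "measure_pmf.variance ?L real = measure_pmf.expectation ?L (\<lambda>k. real (k * (k - 1)))
      + measure_pmf.expectation ?L real - (measure_pmf.expectation ?L real)\<^sup>2"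
  proof -
    have "measure_pmf.expectation ?L (\<lambda>k. (real k)\<^sup>2) = measure_pmf.expectation ?L (\<lambda>k. real (k * (k - 1)) + real k)"
      by (intro Bochner_Integration.integral_cong refl) (auto simp: power2_eq_square algebra_simps of_nat_diff Suc_leI)
    also have "\<dots> = measure_pmf.expectation ?L (\<lambda>k. real (k * (k - 1))) + measure_pmf.expectation ?L real"
      by (rule Bochner_Integration.integral_add) (rule int)+
    finally show ?thesis by (subst measure_pmf.variance_eq) (auto intro: int)
  qed
  have both: "?mean \<and> ?var"
  proof (cases "n = 2")
    case True
    have "measure_pmf.expectation ?L f = f 0" for f :: "nat \<Rightarrow> real"
      by (subst integral_measure_pmf[of "{0}"])
         (use set_pmf_double_deficiency_law[OF n] True in \<open>auto simp: pmf_double_deficiency_law path_coeff_def numeral_eq_Suc\<close>)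
    then show ?thesis unfolding var using True by simp
  next
    case False
    define p where "p = n - 3"
    with False n have np: "n = p + 3" by simp
    define X :: real where "X = fact (2 * p + 2) / (fact p * fact (p + 3))"
    note ratios = central_binomial_ratios[of p, folded X_def]
    have X: "X > 0" by (simp add: X_def)
    define P where "P = real p"
    have P: "P \<ge> 0" by (simp add: P_def)
    have C: "real (2 * n choose n) = 4 * (2 * P + 5) * (2 * P + 3) / (P + 1) * X"
      using ratios(1) by (simp add: np P_def algebra_simps)
    have m1: "measure_pmf.expectation ?L real = (P + 1) * ((2 * P + 4) * (2 * P + 3) / (P + 1) * X) / real (2 * n choose n)"
    proof -
      have "measure_pmf.expectation ?L real = real (\<Sum>k\<le>p + 3. k * path_coeff (p + 3) k) / real (2 * n choose n)"
        unfolding expectation_double_deficiency_law[OF n] unfolding np by simp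
      then show ?thesis unfolding path_coeff_moment1 of_nat_mult ratios(2) by (simp add: P_def)
    qed
    have m2: "measure_pmf.expectation ?L (\<lambda>k. real (k * (k - 1))) = P * ((P - 1) * P * X + 2 * ((2 * P + 3) * X)) / real (2 * n choose n)"
    proof -
      have "measure_pmf.expectation ?L (\<lambda>k. real (k * (k - 1))) = real (\<Sum>k\<le>p + 3. k * (k - 1) * path_coeff (p + 3) k) / real (2 * n choose n)"
        unfolding expectation_double_deficiency_law[OF n] unfolding np by simp
      also have "real (\<Sum>k\<le>p + 3. k * (k - 1) * path_coeff (p + 3) k)
         = real (p - 1) * (real p * real (2 * p + 2 choose (p - 1))) + 2 * real p * real (2 * p + 3 choose p)"
        unfolding path_coeff_moment2 by (simp only: of_nat_mult of_nat_add distrib_left mult_ac of_nat_numeral)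
      also have "\<dots> = P * ((P - 1) * P * X + 2 * ((2 * P + 3) * X))"
        unfolding ratios(3,4) by (cases p) (simp_all add: P_def algebra_simps)
      finally show ?thesis .
    qed
    have nz: "P + 1 \<noteq> 0" "2 * P + 5 \<noteq> 0" "2 * P + 3 \<noteq> 0" using P by auto
    have M1: "measure_pmf.expectation ?L real = (P + 2) * (P + 1) / (2 * (2 * P + 5))"
      unfolding m1 C using X nz by (simp add: divide_simps) (simp add: algebra_simps)
    have M2: "measure_pmf.expectation ?L (\<lambda>k. real (k * (k - 1))) = P * (P + 1) * (P\<^sup>2 + 3 * P + 6) / (4 * (2 * P + 5) * (2 * P + 3))"
      unfolding m2 C using X nz by (simp add: divide_simps) (simp add: algebra_simps power2_eq_square)
    have nP: "real n = P + 3" by (simp add: np P_def)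
    have ?mean unfolding M1 nP by (simp add: algebra_simps)
    moreover have ?var
    proof -
      have e: "real n - 2 = P + 1" "real n + 1 = P + 4" "2 * real n - 1 = 2 * P + 5" "2 * real n - 3 = 2 * P + 3"
        "3 * (real n)\<^sup>2 - 8 * real n + 3 = 3 * P\<^sup>2 + 10 * P + 6"
        by (simp_all add: nP power2_eq_square algebra_simps)
      show ?thesis
        unfolding var unfolding M1 M2 e using nz
        by (simp add: divide_simps) (simp add: power2_eq_square algebra_simps)
    qed
    ultimately show ?thesis ..
  qed
  from both show ?mean by (rule conjunct1)
  from both show ?var by (rule conjunct2)
qed

section \<open>A bounded mean by Stein identities\<close>

text \<open>With \<open>n = k + M + 2\<close> and \<open>k \<ge> 1\<close>, these are the terms of the explicit formula for the number of permutations with \<open>k\<close> double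
  deficiencies, up to the factor \<open>n! / k!\<close>. As \<open>C(M, 2 a)\<close> times a Catalan number equals \<open>M! / (a! (a + 1)! (M - 2 a)!)\<close>, the
  variable \<open>a\<close> is distributed like the number of up steps of a Motzkin path of length \<open>M\<close>, except for
  the slowly varying last two factors.\<close>

definition stein_weight :: "nat \<Rightarrow> nat \<Rightarrow> nat \<Rightarrow> real" where
  "stein_weight k M a = 1 / (fact a * fact (a + 1) * fact (M - 2 * a) * real (k + a + 1) * real (k + a + 2))"

definition stein_sum :: "nat \<Rightarrow> nat \<Rightarrow> (nat \<Rightarrow> real) \<Rightarrow> real" where
  "stein_sum k M f = (\<Sum>a | 2 * a \<le> M. f a * stein_weight k M a)"

lemma stein_weight_pos: "stein_weight k M a > 0"
  by (simp add: stein_weight_def)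

lemma finite_stein_index [simp]: "finite {a :: nat. 2 * a \<le> M}"
  by (rule finite_subset[of _ "{..M}"]) auto

lemma stein_sum_mono:
  "(\<And>a. 2 * a \<le> M \<Longrightarrow> f a \<le> g a) \<Longrightarrow> stein_sum k M f \<le> stein_sum k M g"
  unfolding stein_sum_def by (intro sum_mono mult_right_mono less_imp_le[OF stein_weight_pos]) auto

lemma stein_sum_cong:
  "(\<And>a. 2 * a \<le> M \<Longrightarrow> f a = g a) \<Longrightarrow> stein_sum k M f = stein_sum k M g"
  unfolding stein_sum_def by (intro sum.cong) auto

lemma stein_sum_add: "stein_sum k M (\<lambda>a. f a + g a) = stein_sum k M f + stein_sum k M g"
  and stein_sum_diff: "stein_sum k M (\<lambda>a. f a - g a) = stein_sum k M f - stein_sum k M g"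
  and stein_sum_cmult: "stein_sum k M (\<lambda>a. c * f a) = c * stein_sum k M f"
  by (simp_all add: stein_sum_def sum.distrib sum_subtractf sum_distrib_left algebra_simps)

lemma stein_sum_const: "stein_sum k M (\<lambda>a. c) = c * stein_sum k M (\<lambda>_. 1)"
  using stein_sum_cmult[of k M c "\<lambda>_. 1"] by simp

lemma stein_sum_1_pos: "stein_sum k M (\<lambda>_. 1) > 0"
  unfolding stein_sum_def
  by (rule sum_pos2[of _ 0]) (auto simp: stein_weight_pos less_imp_le)

lemma stein_weight_Suc:
  assumes "2 * Suc a \<le> M"
  shows "stein_weight k M (Suc a) * (real (a + 1) * real (a + 2) * real (k + a + 3) / real (k + a + 1))
       = stein_weight k M a * (real M - 2 * real a) * (real M - 2 * real a - 1)"
proof -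
  obtain d where M: "M = 2 * a + 2 + d" using assms by (auto simp: le_iff_add)
  have nz: "real (k + a + 1) \<noteq> 0" "real (k + a + 2) \<noteq> 0" "real (k + a + 3) \<noteq> 0" "real (a + 1) \<noteq> 0" "real (a + 2) \<noteq> 0"
     "real (d + 1) \<noteq> 0" "real (d + 2) \<noteq> 0"
    by linarith+
  have f: "fact (Suc a) = real (a + 1) * fact a" "fact (Suc a + 1) = real (a + 2) * fact (a + 1)"
    "fact (M - 2 * a) = real (d + 2) * (real (d + 1) * fact d)" "M - 2 * Suc a = d"
    "real M - 2 * real a = real (d + 2)" "real M - 2 * real a - 1 = real (d + 1)"
    "real (k + Suc a + 1) = real (k + a + 2)" "real (k + Suc a + 2) = real (k + a + 3)"
    by (simp_all add: M algebra_simps)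
  show ?thesis unfolding stein_weight_def f using nz fact_nonzero[where 'a=real] by (simp add: divide_simps)
qed

text \<open>Summation by parts. The quotient of consecutive weights is rational in \<open>a\<close>, which gives one identity for
  every test function \<open>f\<close>. At \<open>a = 0\<close>, where \<open>f (a - 1)\<close> means \<open>f 0\<close>, it has coefficient 0.\<close>

lemma stein_identity:
  "stein_sum k M (\<lambda>a. f a * ((real M - 2 * real a) * (real M - 2 * real a - 1)))
   = stein_sum k M (\<lambda>a. f (a - 1) * (real a * (real a + 1) + 2 * real a * (real a + 1) / real (k + a)))"
proof -
  let ?w = "stein_weight k M"
  have "stein_sum k M (\<lambda>a. f (a - 1) * (real a * (real a + 1) + 2 * real a * (real a + 1) / real (k + a)))
     = (\<Sum>a\<in>Suc ` {a. 2 * Suc a \<le> M}. f (a - 1) * (real a * (real a + 1) + 2 * real a * (real a + 1) / real (k + a)) * ?w a)"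
    unfolding stein_sum_def
  proof (rule sum.mono_neutral_right)
    show "\<forall>a\<in>{a. 2 * a \<le> M} - Suc ` {a. 2 * Suc a \<le> M}.
       f (a - 1) * (real a * (real a + 1) + 2 * real a * (real a + 1) / real (k + a)) * ?w a = 0"
    proof
      fix a assume a: "a \<in> {a. 2 * a \<le> M} - Suc ` {a. 2 * Suc a \<le> M}"
      then have "a = 0" by (cases a) auto
      then show "f (a - 1) * (real a * (real a + 1) + 2 * real a * (real a + 1) / real (k + a)) * ?w a = 0" by simp
    qed
  qed auto
  also have "\<dots> = (\<Sum>a | 2 * Suc a \<le> M. f a * ((real M - 2 * real a) * (real M - 2 * real a - 1)) * ?w a)"
  proof (subst sum.reindex, simp, rule sum.cong[OF refl])
    fix a assume a: "a \<in> {a. 2 * Suc a \<le> M}"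
    have r: "real (Suc a) * (real (Suc a) + 1) + 2 * real (Suc a) * (real (Suc a) + 1) / real (k + Suc a)
       = real (a + 1) * real (a + 2) * real (k + a + 3) / real (k + a + 1)"
    proof -
      have "real (k + a + 1) \<noteq> 0" by linarith
      moreover have "real (k + Suc a) = real (k + a + 1)" "real (k + a + 3) = real (k + a + 1) + 2" by simp_all
      ultimately show ?thesis by (simp only: ) (simp add: field_simps)
    qed
    show "((\<lambda>a. f (a - 1) * (real a * (real a + 1) + 2 * real a * (real a + 1) / real (k + a)) * ?w a) \<circ> Suc) a
       = f a * ((real M - 2 * real a) * (real M - 2 * real a - 1)) * ?w a"
      using stein_weight_Suc[of a M k] a unfolding comp_def r by (simp only: mem_Collect_eq diff_Suc_1 mult_ac)
  qed
  also have "\<dots> = stein_sum k M (\<lambda>a. f a * ((real M - 2 * real a) * (real M - 2 * real a - 1)))"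
    unfolding stein_sum_def
  proof (rule sum.mono_neutral_left)
    show "\<forall>a\<in>{a. 2 * a \<le> M} - {a. 2 * Suc a \<le> M}.
      f a * ((real M - 2 * real a) * (real M - 2 * real a - 1)) * ?w a = 0"
    proof
      fix a assume "a \<in> {a. 2 * a \<le> M} - {a. 2 * Suc a \<le> M}"
      then have "M = 2 * a \<or> M = 2 * a + 1" by auto
      then show "f a * ((real M - 2 * real a) * (real M - 2 * real a - 1)) * ?w a = 0" by auto
    qed
  qed auto
  finally show ?thesis by simp
qed

text \<open>Under the weights, \<open>D = M - 3 a\<close> has mean \<open>O(1)\<close>. Since
  \<open>(M - 2 a)\<^sup>2 - a\<^sup>2 = (M - a) D\<close> and \<open>3 (M - a) = 2 M + D\<close>, the identity for \<open>f = 1\<close> reads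
  \<open>E[2 M D + D\<^sup>2] = O(M)\<close>, which bounds the mean of \<open>D\<close> from above and reduces the lower bound to
  \<open>E[D\<^sup>2] = O(M)\<close>. The latter follows from the identity for \<open>f = D\<close>, in which \<open>E[(M - a) D\<^sup>2]\<close> appears
  with \<open>M - a \<ge> M / 2\<close>.\<close>

lemma stein_mean_bound:
  assumes M: "M \<ge> 1"
  shows "\<bar>stein_sum k M (\<lambda>a. real M - 3 * real a)\<bar> \<le> 50 * stein_sum k M (\<lambda>_. 1)"
proof -
  \<comment> \<open>The correction to the identities that comes from the last two factors of the weights.\<close>
  define e where "e a = 2 * real a * (real a + 1) / real (k + a)" for a :: nat
  define D where "D a = real M - 3 * real a" for a :: nat
  let ?S = "stein_sum k M"
  define Z where "Z = ?S (\<lambda>_. 1)"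
  define m where "m = real M"
  have m: "m \<ge> 1" using M by (simp add: m_def)
  have Z: "Z > 0" by (simp add: Z_def stein_sum_1_pos)
  have e: "0 \<le> e a" "e a \<le> 2 * real a + 2" for a
  proof -
    show "0 \<le> e a" by (simp add: e_def)
    show "e a \<le> 2 * real a + 2"
    proof (cases "a = 0")
      case False
      then have "2 * real a * (real a + 1) \<le> (2 * real a + 2) * real (k + a)"
        by (simp add: algebra_simps)
      then show ?thesis using False by (simp add: e_def divide_simps)
    qed (simp add: e_def)
  qed
  have a: "real a \<le> m / 2" if "2 * a \<le> M" for a using that by (simp add: m_def)
  \<comment> \<open>The test function \<open>f = 1\<close>, multiplied by 3.\<close>
  have first: "?S (\<lambda>a. 2 * m * D a + D a ^ 2) = ?S (\<lambda>a. 3 * (m - real a + e a))"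
  proof -
    have "?S (\<lambda>a. 2 * m * D a + D a ^ 2) - ?S (\<lambda>a. 3 * (m - real a + e a))
      = ?S (\<lambda>a. 3 * (1 * ((real M - 2 * real a) * (real M - 2 * real a - 1)) - 1 * (real a * (real a + 1) + e a)))"
      unfolding stein_sum_diff[symmetric]
      by (rule stein_sum_cong) (simp add: D_def m_def power2_eq_square algebra_simps)
    also have "\<dots> = 0"
      unfolding stein_sum_cmult stein_sum_diff using stein_identity[of k M "\<lambda>_. 1"] by (simp add: e_def)
    finally show ?thesis by simp
  qed
  \<comment> \<open>The test function \<open>f = D\<close>; \<open>D (a - 1) = D a + 3\<close> for \<open>a > 0\<close>.\<close>
  have second: "?S (\<lambda>a. D a ^ 2 * (m - real a)) = ?S (\<lambda>a. D a * (m - real a + e a) + 3 * (real a * (real a + 1) + e a))"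
  proof -
    have "?S (\<lambda>a. D a ^ 2 * (m - real a)) - ?S (\<lambda>a. D a * (m - real a + e a) + 3 * (real a * (real a + 1) + e a))
      = ?S (\<lambda>a. D a * ((real M - 2 * real a) * (real M - 2 * real a - 1)) - D (a - 1) * (real a * (real a + 1) + e a))"
      unfolding stein_sum_diff[symmetric]
    proof (rule stein_sum_cong)
      fix a
      have "D (a - 1) * (real a * (real a + 1) + e a) = (D a + 3) * (real a * (real a + 1) + e a)"
        by (cases a) (simp_all add: D_def e_def)
      then show "D a ^ 2 * (m - real a) - (D a * (m - real a + e a) + 3 * (real a * (real a + 1) + e a))
        = D a * ((real M - 2 * real a) * (real M - 2 * real a - 1)) - D (a - 1) * (real a * (real a + 1) + e a)"
        by (simp add: D_def m_def power2_eq_square algebra_simps)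
    qed
    also have "\<dots> = 0"
      unfolding stein_sum_diff using stein_identity[of k M D] by (simp add: e_def)
    finally show ?thesis by simp
  qed
  define y where "y = ?S (\<lambda>a. D a ^ 2)"
  have y0: "y \<ge> 0"
    using stein_sum_mono[of M "\<lambda>_. 0" "\<lambda>a. D a ^ 2" k] by (simp add: y_def stein_sum_def)
  have "m / 2 * y = ?S (\<lambda>a. m / 2 * D a ^ 2)" by (simp only: y_def stein_sum_cmult)
  also have "\<dots> \<le> ?S (\<lambda>a. D a ^ 2 * (m - real a))"
  proof (rule stein_sum_mono)
    fix b :: nat assume "2 * b \<le> M"
    from a[OF this] have "m / 2 \<le> m - real b" by simp
    then have "D b ^ 2 * (m / 2) \<le> D b ^ 2 * (m - real b)" by (intro mult_left_mono) auto
    then show "m / 2 * D b ^ 2 \<le> D b ^ 2 * (m - real b)" by (simp add: mult.commute)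
  qed
  also have "\<dots> \<le> ?S (\<lambda>a. m / 4 * D a ^ 2 + 24 * m ^ 2)"
    unfolding second
  proof (rule stein_sum_mono)
    fix b :: nat assume b: "2 * b \<le> M"
    note ab = a[OF b]
    \<comment> \<open>The cross term is absorbed into half of the quadratic term on the left of the estimate.\<close>
    define x where "x = m - real b + e b"
    have x: "0 \<le> x" "x \<le> 7 / 2 * m" using e[of b] ab m by (auto simp: x_def)
    have "0 \<le> (m * D b / 2 - x) ^ 2" by simp
    then have "m * (D b * x) \<le> m * (m / 4 * D b ^ 2) + x ^ 2" by (simp add: power2_eq_square algebra_simps)
    also have "x ^ 2 \<le> (7 / 2 * m) ^ 2" using x by (intro power_mono)
    also have "(7 / 2 * m) ^ 2 = m * (49 / 4 * m)" by (simp add: power2_eq_square)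
    finally have "m * (D b * x) \<le> m * (m / 4 * D b ^ 2 + 49 / 4 * m)" by (simp only: distrib_left add_left_mono)
    then have 1: "D b * x \<le> m / 4 * D b ^ 2 + 49 / 4 * m" using m by simp
    have "real b * (real b + 1) \<le> m / 2 * (m / 2 + 1)" using ab by (intro mult_mono) auto
    then have 2: "3 * (real b * (real b + 1) + e b) \<le> 3 * (m / 2 * (m / 2 + 1) + (m + 2))"
      using e[of b] ab by (intro mult_left_mono add_mono) auto
    have mm: "m \<le> m ^ 2" "1 \<le> m ^ 2" using m by (auto simp: power2_eq_square intro: order_trans)
    have "3 * (m / 2 * (m / 2 + 1) + (m + 2)) = 3 / 4 * m ^ 2 + 9 / 2 * m + 6"
      by (simp add: power2_eq_square algebra_simps)
    with 1 2 mm show "D b * (m - real b + e b) + 3 * (real b * (real b + 1) + e b) \<le> m / 4 * D b ^ 2 + 24 * m ^ 2"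
      unfolding x_def by linarith
  qed
  also have "\<dots> = m / 4 * y + 24 * m ^ 2 * Z"
    unfolding stein_sum_add y_def stein_sum_cmult Z_def stein_sum_const[of k M "m ^ 2"] by simp
  finally have "m / 2 * y \<le> m / 4 * y + 24 * m ^ 2 * Z" .
  moreover have "24 * m ^ 2 * Z = m / 4 * (96 * m * Z)" by (simp add: power2_eq_square)
  ultimately have "m / 4 * y \<le> m / 4 * (96 * m * Z)" by linarith
  then have y: "y \<le> 96 * m * Z" by (rule mult_left_le_imp_le) (use m in simp)
  have DE: "2 * m * ?S D + y = ?S (\<lambda>a. 3 * (m - real a + e a))"
    using first unfolding stein_sum_add stein_sum_cmult y_def .
  have "0 \<le> ?S (\<lambda>a. 3 * (m - real a + e a))"
    unfolding stein_sum_def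
  proof (intro sum_nonneg mult_nonneg_nonneg)
    fix b :: nat assume "b \<in> {a. 2 * a \<le> M}"
    then show "0 \<le> m - real b + e b" using a[of b] e(1)[of b] m by simp
  qed (simp_all add: less_imp_le[OF stein_weight_pos])
  moreover have "?S (\<lambda>a. 3 * (m - real a + e a)) \<le> ?S (\<lambda>_. 11 * m)"
  proof (rule stein_sum_mono)
    fix b :: nat assume "2 * b \<le> M"
    from a[OF this] e[of b] m show "3 * (m - real b + e b) \<le> 11 * m" by simp
  qed
  then have "?S (\<lambda>a. 3 * (m - real a + e a)) \<le> 11 * m * Z" using stein_sum_const[of k M "11 * m"] by (simp add: Z_def)
  ultimately have "- (2 * m * (48 * Z)) \<le> 2 * m * ?S D" "2 * m * ?S D \<le> 2 * m * (6 * Z)"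
    using DE y y0 mult_pos_pos[of m Z] m Z by linarith+
  then have "2 * m * (- (48 * Z)) \<le> 2 * m * ?S D" and upper: "2 * m * ?S D \<le> 2 * m * (6 * Z)"
    by simp_all
  from this(1) have "- (48 * Z) \<le> ?S D"
    by (rule mult_left_le_imp_le) (use m in simp)
  moreover from upper have "?S D \<le> 6 * Z"
    by (rule mult_left_le_imp_le) (use m in simp)
  ultimately have "- (48 * Z) \<le> ?S D" "?S D \<le> 6 * Z" by simp_all
  then show ?thesis using Z unfolding Z_def D_def[abs_def] by linarith
qed

section \<open>The density with respect to the binomial law\<close>

text \<open>Substitute \<open>j = M + 1 - a\<close>, so that \<open>n - j - k = a + 1\<close>; the products of binomial coefficients then collapse.\<close>

lemma path_coeff_stein_sum:
  assumes k: "k \<ge> 1" and n: "n = k + M + 2"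
  shows "real (path_coeff n k) = fact (n + 1) / fact k * stein_sum k M (\<lambda>_. 1)"
proof -
  define t where "t j = real ((n + 1 choose j) * (n - 1 - j choose k) * (j choose (n - j - k)))" for j
  have zero: "t j = 0" if "j < n" "\<not> (\<exists>a. 2 * a \<le> M \<and> j = M + 1 - a)" for j
  proof (cases "j \<le> M + 1")
    case True
    define a where "a = M + 1 - j"
    have a: "j = M + 1 - a" "a \<le> M + 1" using True by (auto simp: a_def)
    have "\<not> 2 * a \<le> M" using that(2) a(1) by blast
    then have "(j choose (n - j - k)) = 0" using a n by (intro binomial_eq_0) linarith
    then show ?thesis by (simp add: t_def)
  next
    case False
    then have "(n - 1 - j choose k) = 0" using k n that(1) by (intro binomial_eq_0) linarith
    then show ?thesis by (simp add: t_def)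
  qed
  have summand: "t (M + 1 - a) = fact (n + 1) / fact k * stein_weight k M a" if "2 * a \<le> M" for a
  proof -
    obtain d where M: "M = 2 * a + d" using \<open>2 * a \<le> M\<close> le_Suc_ex by blast
    define j where "j = a + d + 1"
    have e: "M + 1 - a = j" "n + 1 = j + (k + a + 2)" "n - 1 - j = k + a" "n - j - k = a + 1" "j = (a + 1) + d" "M - 2 * a = d"
      using n M by (auto simp: j_def)
    have "t (M + 1 - a) = real (j + (k + a + 2) choose j) * real (k + a choose k) * real ((a + 1) + d choose (a + 1))"
      unfolding t_def of_nat_mult e(1,3,4) e(2) by (subst (3) e(5)) (rule refl)
    also have "\<dots> = fact (n + 1) / (fact j * fact (k + a + 2)) * (fact (k + a) / (fact k * fact a)) * (fact j / (fact (a + 1) * fact d))"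
      unfolding binomial_add_fact e(2) by (subst (4) e(5)) (rule refl)
    also have "fact (k + a + 2) = real (k + a + 2) * (real (k + a + 1) * fact (k + a))"
      by (simp add: numeral_2_eq_2)
    finally have "t (M + 1 - a) = fact (n + 1) / (fact j * (real (k + a + 2) * (real (k + a + 1) * fact (k + a))))
       * (fact (k + a) / (fact k * fact a)) * (fact j / (fact (a + 1) * fact d))" .
    moreover have "(fact j :: real) \<noteq> 0" "(fact (k + a) :: real) \<noteq> 0" by simp_all
    ultimately show ?thesis unfolding stein_weight_def e(6)
      by (simp add: divide_simps del: fact_Suc) (simp only: mult_ac)
  qed
  have "real (path_coeff n k) = (\<Sum>j<n. t j)" using k by (simp add: path_coeff_def t_def)
  also have "\<dots> = (\<Sum>j\<in>(\<lambda>a. M + 1 - a) ` {a. 2 * a \<le> M}. t j)"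
    using zero n by (intro sum.mono_neutral_right) auto
  also have "\<dots> = (\<Sum>a | 2 * a \<le> M. t (M + 1 - a))"
    by (subst sum.reindex) (auto simp: inj_on_def)
  also have "\<dots> = (\<Sum>a | 2 * a \<le> M. fact (n + 1) / fact k * stein_weight k M a)"
    by (intro sum.cong refl summand) simp
  finally show ?thesis by (simp add: stein_sum_def sum_distrib_left)
qed

text \<open>Passing from \<open>k\<close> to \<open>k + 1\<close> at fixed \<open>n\<close> reweights the same sum by a rational function of \<open>a\<close>.\<close>

lemma stein_sum_shift:
  assumes "M \<ge> 1"
  shows "stein_sum (k + 1) (M - 1) (\<lambda>_. 1)
     = stein_sum k M (\<lambda>a. (real M - 2 * real a) * real (k + a + 1) / real (k + a + 3))"
proof -
  have w: "stein_weight (k + 1) (M - 1) a = (real M - 2 * real a) * real (k + a + 1) / real (k + a + 3) * stein_weight k M a"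
    if le: "2 * a \<le> M - 1" for a
  proof -
    obtain d where "M - 1 = 2 * a + d" using le_Suc_ex[OF le] by blast
    then have M: "M = 2 * a + d + 1" using assms by linarith
    have e: "M - 1 - 2 * a = d" "real M - 2 * real a = real (d + 1)" "k + 1 + a + 1 = k + a + 2" "k + 1 + a + 2 = k + a + 3"
      unfolding M by simp_all
    have "M - 2 * a = Suc d" unfolding M by simp
    then have f: "fact (M - 2 * a) = real (d + 1) * fact d" by simp
    have nz: "real (k + a + 1) \<noteq> 0" "real (d + 1) \<noteq> 0" by linarith+
    have cancel: "1 / (A * B * F * v * w) = D * u / w * (1 / (A * B * (D * F) * u * v))"
      if "D \<noteq> 0" "u \<noteq> 0" for A B F u v w D :: real
      using that by (simp add: divide_simps)
    show ?thesis unfolding stein_weight_def e f by (rule cancel[OF nz(2,1)])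
  qed
  have "stein_sum (k + 1) (M - 1) (\<lambda>_. 1) = (\<Sum>a | 2 * a \<le> M - 1. (real M - 2 * real a) * real (k + a + 1) / real (k + a + 3) * stein_weight k M a)"
    unfolding stein_sum_def by (intro sum.cong refl) (simp only: mult_1_left w mem_Collect_eq)
  also have "\<dots> = stein_sum k M (\<lambda>a. (real M - 2 * real a) * real (k + a + 1) / real (k + a + 3))"
    unfolding stein_sum_def
  proof (rule sum.mono_neutral_left)
    show "\<forall>a\<in>{a. 2 * a \<le> M} - {a. 2 * a \<le> M - 1}.
       (real M - 2 * real a) * real (k + a + 1) / real (k + a + 3) * stein_weight k M a = 0"
    proof
      fix a assume "a \<in> {a. 2 * a \<le> M} - {a. 2 * a \<le> M - 1}"
      then have "M = 2 * a" by auto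
      then show "(real M - 2 * real a) * real (k + a + 1) / real (k + a + 3) * stein_weight k M a = 0" by simp
    qed
  qed auto
  finally show ?thesis .
qed

text \<open>In \<open>stein_sum_shift\<close> write \<open>3 (M - 2 a) = M + 2 (M - 3 a)\<close>, where \<open>M - 3 a\<close> has bounded mean, and
  \<open>(k + a + 1) / (k + a + 3) = 1 - O(1 / k)\<close>.\<close>

lemma stein_ratio:
  assumes M: "M \<ge> 1" and k: "k \<ge> 1"
  shows "\<bar>3 * stein_sum (k + 1) (M - 1) (\<lambda>_. 1) - real M * stein_sum k M (\<lambda>_. 1)\<bar>
     \<le> (100 + 6 * real M / real k) * stein_sum k M (\<lambda>_. 1)"
proof -
  let ?S = "stein_sum k M"
  define r where "r a = 6 * (real M - 2 * real a) / real (k + a + 3)" for a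
  have "3 * stein_sum (k + 1) (M - 1) (\<lambda>_. 1) - real M * ?S (\<lambda>_. 1)
      = ?S (\<lambda>a. 3 * ((real M - 2 * real a) * real (k + a + 1) / real (k + a + 3)) - real M * 1)"
    unfolding stein_sum_shift[OF M] stein_sum_diff stein_sum_cmult ..
  also have "\<dots> = ?S (\<lambda>a. 2 * (real M - 3 * real a) - r a)"
  proof (rule stein_sum_cong)
    fix a
    have "real (k + a + 1) / real (k + a + 3) = 1 - 2 / real (k + a + 3)" by (simp add: field_simps)
    then have "3 * ((real M - 2 * real a) * real (k + a + 1) / real (k + a + 3)) = 3 * (real M - 2 * real a) * (1 - 2 / real (k + a + 3))"
      by (metis mult.assoc times_divide_eq_right)
    then show "3 * ((real M - 2 * real a) * real (k + a + 1) / real (k + a + 3)) - real M * 1 = 2 * (real M - 3 * real a) - r a"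
      by (simp add: r_def algebra_simps diff_divide_distrib)
  qed
  also have "\<dots> = 2 * ?S (\<lambda>a. real M - 3 * real a) - ?S r"
    unfolding stein_sum_diff stein_sum_cmult ..
  finally have eq: "3 * stein_sum (k + 1) (M - 1) (\<lambda>_. 1) - real M * ?S (\<lambda>_. 1) = \<dots>" .
  have "?S (\<lambda>_. 0) \<le> ?S r" by (rule stein_sum_mono) (auto simp: r_def)
  then have r0: "0 \<le> ?S r" by (simp add: stein_sum_def)
  have "?S r \<le> ?S (\<lambda>_. 6 * real M / real k)"
    by (rule stein_sum_mono) (use k in \<open>auto simp: r_def intro!: frac_le\<close>)
  then have r1: "?S r \<le> 6 * real M / real k * ?S (\<lambda>_. 1)"
    using stein_sum_const[of k M "6 * real M / real k"] by simp
  show ?thesis unfolding eq distrib_right using stein_mean_bound[OF M, of k] r0 r1 by linarith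
qed

text \<open>The binomial probabilities have quotient \<open>M / (3 (k + 1))\<close> with \<open>M = n - 2 - k\<close>, which is
  what \<open>stein_ratio\<close> compares with.\<close>

lemma law_binomial_ratio_step:
  fixes n k :: nat
  defines "G \<equiv> \<lambda>k. pmf (double_deficiency_law n) k / pmf (binomial_pmf (n - 2) (1 / 4)) k"
  assumes k: "k \<ge> 1" "k + 1 \<le> n - 2"
  shows "\<bar>G (k + 1) - G k\<bar> \<le> (100 / real (n - 2 - k) + 6 / real k) * G k" and "G k > 0"
proof -
  define M where "M = n - 2 - k"
  have M: "M \<ge> 1" and n: "n = k + M + 2" and n': "n = (k + 1) + (M - 1) + 2" using k by (auto simp: M_def)
  define c where "c = fact (n + 1) / real (2 * n choose n)"
  have c: "c > 0" by (simp add: c_def del: fact_Suc)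
  define S where "S = stein_sum k M (\<lambda>_. 1)"
  define S' where "S' = stein_sum (k + 1) (M - 1) (\<lambda>_. 1)"
  have S: "S > 0" by (simp add: S_def stein_sum_1_pos)
  define b where "b = pmf (binomial_pmf (n - 2) (1 / 4)) k"
  have b: "b > 0" using n by (simp add: b_def)
  have p0: "pmf (double_deficiency_law n) k = c * S / fact k"
    unfolding pmf_double_deficiency_law path_coeff_stein_sum[OF k(1) n] c_def S_def by simp
  have p1: "pmf (double_deficiency_law n) (k + 1) = c * S' / (real (k + 1) * fact k)"
    unfolding pmf_double_deficiency_law path_coeff_stein_sum[OF le_add2 n'] c_def S'_def by (simp add: mult_ac)
  have b1: "pmf (binomial_pmf (n - 2) (1 / 4)) (k + 1) = b * (real M / (3 * real (k + 1)))"
  proof -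
    have "real (k + 1) * real (n - 2 choose (k + 1)) = real M * real (n - 2 choose k)"
      using binomial_absorb_comp[of "n - 2" k] binomial_absorption[of k "n - 2"]
      unfolding of_nat_mult[symmetric] by (simp add: M_def)
    then have "real (n - 2 choose (k + 1)) = real M * real (n - 2 choose k) / real (k + 1)"
      by (simp add: divide_simps mult_ac)
    moreover have "C * (1 / 4 * x) * y = C' * x * (3 / 4 * y) * (m / (3 * l))" if "C = m * C' / l"
      for C C' x y m l :: real
      using that by (simp add: mult_ac)
    ultimately have key: "real (n - 2 choose (k + 1)) * (1 / 4 * (1 / 4) ^ k) * (3 / 4) ^ (n - 2 - (k + 1))
      = real (n - 2 choose k) * (1 / 4) ^ k * (3 / 4 * (3 / 4) ^ (n - 2 - (k + 1))) * (real M / (3 * real (k + 1)))"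
      by blast
    have e: "n - 2 - k = Suc (n - 2 - (k + 1))" using k by simp
    have pb: "pmf (binomial_pmf (n - 2) (1 / 4)) j = real (n - 2 choose j) * (1 / 4) ^ j * (3 / 4) ^ (n - 2 - j)" for j
      by simp
    show ?thesis using key unfolding b_def pb e by (simp only: power_Suc Suc_eq_plus1[symmetric])
  qed
  have G0: "G k = c * S / (fact k * b)" by (simp add: G_def p0 b_def)
  then show "G k > 0" using c S b by simp
  have M0: "real M > 0" using M by simp
  have "G (k + 1) = c * (3 * S' / real M) / (fact k * b)"
    unfolding G_def p1 b1 using M0 b by (simp add: divide_simps)
  then have "G (k + 1) - G k = c / (real M * fact k * b) * (3 * S' - real M * S)"
    unfolding G0 using M0 b by (simp add: right_diff_distrib)
  then have "\<bar>G (k + 1) - G k\<bar> = \<bar>c / (real M * fact k * b) * (3 * S' - real M * S)\<bar>"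
    by (rule arg_cong)
  also have "\<dots> = c / (real M * fact k * b) * \<bar>3 * S' - real M * S\<bar>"
    using c M0 b by (simp add: abs_mult)
  also have "\<dots> \<le> c / (real M * fact k * b) * ((100 + 6 * real M / real k) * S)"
    unfolding S'_def S_def using c M0 b by (intro mult_left_mono stein_ratio M k) auto
  also have "\<dots> = (100 / real M + 6 / real k) * G k"
    unfolding G0 using M0 b k by (simp add: field_simps)
  finally show "\<bar>G (k + 1) - G k\<bar> \<le> (100 / real (n - 2 - k) + 6 / real k) * G k" by (simp add: M_def)
qed

section \<open>Total variation distance\<close>

lemma near_equal_ratio:
  fixes x y e :: real
  assumes "\<bar>x - y\<bar> \<le> e * y" "0 \<le> e" "e \<le> 1 / 2" "y > 0"
  shows "x \<le> (1 + 2 * e) * y" and "y \<le> (1 + 2 * e) * x"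
proof -
  have ey: "0 \<le> e * y" using assms by simp
  show "x \<le> (1 + 2 * e) * y" using assms(1) ey by (simp add: algebra_simps)
  have "y = (1 + 2 * e) * ((1 - e) * y) - e * (1 - 2 * e) * y" by (simp add: algebra_simps power2_eq_square)
  also have "\<dots> \<le> (1 + 2 * e) * ((1 - e) * y)" using assms by simp
  also have "\<dots> \<le> (1 + 2 * e) * x" using assms(1,2) by (intro mult_left_mono) (simp_all add: algebra_simps)
  finally show "y \<le> (1 + 2 * e) * x" .
qed

text \<open>Both directions are kept so that the chain can be run to the left and to the right of a reference point.\<close>

lemma ratio_chain:
  fixes G :: "nat \<Rightarrow> real"
  assumes step: "\<And>k. lo \<le> k \<Longrightarrow> k < hi \<Longrightarrow> \<bar>G (Suc k) - G k\<bar> \<le> e * G k"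
    and pos: "\<And>k. lo \<le> k \<Longrightarrow> k < hi \<Longrightarrow> G k > 0"
    and e: "0 \<le> e" "e \<le> 1 / 2"
  shows "lo \<le> k \<Longrightarrow> k + d \<le> hi \<Longrightarrow> G (k + d) \<le> (1 + 2 * e) ^ d * G k \<and> G k \<le> (1 + 2 * e) ^ d * G (k + d)"
proof (induction d)
  case (Suc d)
  have IH: "G (k + d) \<le> (1 + 2 * e) ^ d * G k" "G k \<le> (1 + 2 * e) ^ d * G (k + d)" using Suc by auto
  have kd: "lo \<le> k + d" "k + d < hi" using Suc by auto
  note st = near_equal_ratio[OF step[OF kd] e pos[OF kd]]
  have R: "0 \<le> 1 + 2 * e" using e by simp
  have "G (k + Suc d) \<le> (1 + 2 * e) * ((1 + 2 * e) ^ d * G k)"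
    using order_trans[OF st(1) mult_left_mono[OF IH(1) R]] by simp
  moreover have "G k \<le> (1 + 2 * e) ^ d * ((1 + 2 * e) * G (Suc (k + d)))"
    by (rule order_trans[OF IH(2) mult_left_mono[OF st(2)]]) (use R in simp)
  ultimately show ?case by (simp add: mult_ac)
qed simp

lemma sum_abs_deviation_le:
  fixes b :: "nat \<Rightarrow> real"
  assumes "finite A" "\<And>k. k \<in> A \<Longrightarrow> b k \<ge> 0" "(\<Sum>k\<in>A. b k) \<le> 1" "(\<Sum>k\<in>A. b k * (real k - c)\<^sup>2) \<le> V" "r > 0"
  shows "(\<Sum>k\<in>A. b k * \<bar>real k - c\<bar>) \<le> (V / r + r) / 2"
proof -
  have am: "\<bar>x\<bar> \<le> (x\<^sup>2 / r + r) / 2" for x :: real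
  proof -
    have "0 \<le> (\<bar>x\<bar> - r)\<^sup>2" by simp
    then have "2 * r * \<bar>x\<bar> \<le> x\<^sup>2 + r\<^sup>2" by (simp add: power2_diff mult_ac)
    then show ?thesis using \<open>r > 0\<close> by (simp add: field_simps power2_eq_square)
  qed
  have "(\<Sum>k\<in>A. b k * \<bar>real k - c\<bar>) \<le> (\<Sum>k\<in>A. b k * (((real k - c)\<^sup>2 / r + r) / 2))"
    using assms am by (intro sum_mono mult_left_mono) auto
  also have "\<dots> = (\<Sum>k\<in>A. (b k * (real k - c)\<^sup>2 / r + r * b k) / 2)"
    using \<open>r > 0\<close> by (intro sum.cong) (simp_all add: field_simps)
  also have "\<dots> = ((\<Sum>k\<in>A. b k * (real k - c)\<^sup>2) / r + r * (\<Sum>k\<in>A. b k)) / 2"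
    unfolding sum_divide_distrib[symmetric] sum.distrib sum_distrib_left ..
  also have "\<dots> \<le> (V / r + r * 1) / 2"
    using assms by (intro divide_right_mono add_mono mult_left_mono) auto
  finally show ?thesis by simp
qed

text \<open>Chebyshev's inequality for finitely supported weights.\<close>

lemma sum_tail_le:
  fixes b :: "nat \<Rightarrow> real"
  assumes "finite A" "\<And>k. k \<in> A \<Longrightarrow> b k \<ge> 0" "(\<Sum>k\<in>A. b k * (real k - c)\<^sup>2) \<le> V" "w > 0"
    and "T \<subseteq> A" "\<And>k. k \<in> T \<Longrightarrow> w \<le> \<bar>real k - c\<bar>"
  shows "(\<Sum>k\<in>T. b k) \<le> V / w\<^sup>2"
proof -
  have "w\<^sup>2 * (\<Sum>k\<in>T. b k) = (\<Sum>k\<in>T. b k * w\<^sup>2)"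
    unfolding sum_distrib_left by (simp only: mult.commute)
  also have "\<dots> \<le> (\<Sum>k\<in>T. b k * (real k - c)\<^sup>2)"
  proof (rule sum_mono)
    fix k assume "k \<in> T"
    then have "w\<^sup>2 \<le> (real k - c)\<^sup>2" "b k \<ge> 0" using assms power_mono[of w "\<bar>real k - c\<bar>" 2] by auto
    then show "b k * w\<^sup>2 \<le> b k * (real k - c)\<^sup>2" by (rule mult_left_mono)
  qed
  also have "\<dots> \<le> (\<Sum>k\<in>A. b k * (real k - c)\<^sup>2)" using assms by (intro sum_mono2) auto
  also have "\<dots> \<le> V" by fact
  finally show ?thesis using \<open>w > 0\<close> by (simp add: field_simps)
qed

text \<open>Compare \<open>p\<close> with \<open>g b\<close>, where \<open>g\<close> is the value of \<open>p / b\<close> at the reference point \<open>c\<close>. At distance \<open>d\<close> from \<open>c\<close> inside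
  the window the ratio has drifted from \<open>g\<close> by a relative error of at most \<open>B d / n\<close>, and \<open>d\<close> is of order
  \<open>n\<^sup>1\<^sup>/\<^sup>2\<close> on average, by the second moment. Outside the window, which has width of order \<open>n\<close>,
  Chebyshev's inequality bounds both masses by \<open>O(1/n)\<close>. As both masses sum to 1, \<open>g\<close> itself is \<open>1 + O(n\<^sup>-\<^sup>1\<^sup>/\<^sup>2)\<close>.\<close>

lemma l1_distance_from_slow_ratio:
  fixes p b :: "nat \<Rightarrow> real" and n N c lo hi :: nat and K L :: real
  defines "B \<equiv> 2 * L * exp (2 * L)"
  assumes p: "\<And>k. k \<le> N \<Longrightarrow> p k \<ge> 0" "(\<Sum>k\<le>N. p k) = 1" "(\<Sum>k\<le>N. p k * (real k - real c)\<^sup>2) \<le> K * real n"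
    and b: "\<And>k. k \<le> N \<Longrightarrow> b k > 0" "(\<Sum>k\<le>N. b k) = 1" "(\<Sum>k\<le>N. b k * (real k - real c)\<^sup>2) \<le> K * real n"
    and n: "n > 0" "0 \<le> L" "2 * L \<le> real n" "0 \<le> K"
    and window: "lo \<le> c" "c < hi" "hi \<le> N" "hi \<le> n"
    and outside: "\<And>k. k < lo \<or> hi < k \<Longrightarrow> real n / 16 \<le> \<bar>real k - real c\<bar>"
    and step: "\<And>k. lo \<le> k \<Longrightarrow> k < hi \<Longrightarrow> \<bar>p (Suc k) / b (Suc k) - p k / b k\<bar> \<le> L / n * (p k / b k)"
    and pos: "\<And>k. lo \<le> k \<Longrightarrow> k < hi \<Longrightarrow> p k / b k > 0"
  shows "(\<Sum>k\<le>N. \<bar>p k - b k\<bar>) \<le> (2 * B * (K + 1) + 1280 * K) / sqrt n"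
proof -
  define r where "r = sqrt (real n)"
  define W where "W = {lo..hi}"
  define T where "T = {..N} - W"
  define G where "G k = p k / b k" for k
  define g where "g = G c"
  have r: "r > 0" "r * r = real n" "1 \<le> r" using n by (auto simp: r_def)
  have WN: "W \<subseteq> {..N}" using window by (auto simp: W_def)
  have split: "(\<Sum>k\<le>N. f k) = (\<Sum>k\<in>W. f k) + (\<Sum>k\<in>T. f k)" for f :: "nat \<Rightarrow> real"
    unfolding T_def using WN by (subst sum.subset_diff[of W]) auto
  have g: "g > 0" unfolding g_def G_def using pos window by blast
  have B: "B \<ge> 0" using n by (simp add: B_def)
  define e where "e = L / real n"
  have e: "0 \<le> e" "e \<le> 1 / 2" using n by (auto simp: e_def field_simps)
  have pG: "p k = G k * b k" if "k \<in> W" for k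
    using b(1)[of k] WN that by (auto simp: G_def)
  have Gdiff: "\<bar>G k - g\<bar> \<le> B * \<bar>real k - real c\<bar> / real n * g" if k: "k \<in> W" for k
  proof -
    define d where "d = (if k \<le> c then c - k else k - c)"
    have d: "real d = \<bar>real k - real c\<bar>" by (auto simp: d_def of_nat_diff)
    have dn: "real d \<le> real n" using k window by (auto simp: d_def W_def)
    have chain: "G k \<le> (1 + 2 * e) ^ d * g \<and> g \<le> (1 + 2 * e) ^ d * G k"
    proof (cases "k \<le> c")
      case True
      have "G (k + (c - k)) \<le> (1 + 2 * e) ^ (c - k) * G k \<and> G k \<le> (1 + 2 * e) ^ (c - k) * G (k + (c - k))"
        using k window True step pos e by (intro ratio_chain[of lo hi]) (auto simp: W_def G_def e_def)
      then show ?thesis using True by (simp add: d_def g_def)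
    next
      case False
      have "G (c + (k - c)) \<le> (1 + 2 * e) ^ (k - c) * G c \<and> G c \<le> (1 + 2 * e) ^ (k - c) * G (c + (k - c))"
        using k window False step pos e by (intro ratio_chain[of lo hi]) (auto simp: W_def G_def e_def)
      then show ?thesis using False by (simp add: d_def g_def)
    qed
    define D where "D = B * real d / real n"
    have D: "D \<ge> 0" using B by (simp add: D_def)
    have R: "(1 + 2 * e) ^ d \<le> 1 + D"
    proof -
      define x where "x = 2 * e * real d"
      have x: "0 \<le> x" "x \<le> 2 * L"
      proof -
        show "0 \<le> x" using e by (simp add: x_def)
        have "2 * L * (real d / real n) \<le> 2 * L * 1"
          using n dn by (intro mult_left_mono) auto
        then show "x \<le> 2 * L" by (simp add: x_def e_def)
      qed
      have "(1 + 2 * e) ^ d \<le> exp (2 * e) ^ d" using e by (intro power_mono exp_ge_add_one_self) auto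
      also have "\<dots> = exp x" by (simp add: x_def exp_of_nat_mult[symmetric] mult.commute)
      also have "exp x \<le> 1 + x * exp x"
      proof -
        have "exp x * (1 - x) \<le> exp x * exp (- x)" using exp_ge_add_one_self[of "- x"] by (intro mult_left_mono) auto
        then show ?thesis by (simp add: exp_minus algebra_simps)
      qed
      also have "\<dots> \<le> 1 + x * exp (2 * L)" using x by (intro add_mono mult_left_mono) auto
      also have "x * exp (2 * L) = D" by (simp add: x_def D_def B_def e_def)
      finally show ?thesis .
    qed
    have le: "G k \<le> (1 + D) * g" "g \<le> (1 + D) * G k"
    proof -
      show 1: "G k \<le> (1 + D) * g" using chain mult_right_mono[OF R, of g] g by linarith
      have "0 < (1 + 2 * e) ^ d * G k" using chain g by linarith
      moreover have "0 < (1 + 2 * e) ^ d" using e by simp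
      ultimately have "0 < G k" by (metis zero_less_mult_pos)
      then show "g \<le> (1 + D) * G k" using chain mult_right_mono[OF R, of "G k"] by linarith
    qed
    have "G k - g \<le> D * g" using le(1) by (simp add: algebra_simps)
    moreover have "g - G k \<le> D * g"
    proof (cases "G k \<le> g")
      case True
      then have "D * G k \<le> D * g" using D by (rule mult_left_mono)
      then show ?thesis using le(2) by (simp add: algebra_simps)
    next
      case False
      then show ?thesis using D g mult_nonneg_nonneg[of D g] by linarith
    qed
    ultimately show ?thesis by (simp add: D_def d abs_le_iff)
  qed
  \<comment> \<open>The two error terms: drift of the ratio inside the window, and mass outside it.\<close>
  define \<eta> where "\<eta> = B * (K + 1) / (2 * r)"
  define \<tau> where "\<tau> = 256 * K / r"
  have \<eta>0: "0 \<le> \<eta>" and \<tau>0: "0 \<le> \<tau>" using B n r by (simp_all add: \<eta>_def \<tau>_def)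
  have near: "(\<Sum>k\<in>W. \<bar>p k - g * b k\<bar>) \<le> g * \<eta>"
  proof -
    have "(\<Sum>k\<in>W. \<bar>p k - g * b k\<bar>) \<le> (\<Sum>k\<in>W. g * B / real n * (b k * \<bar>real k - real c\<bar>))"
    proof (rule sum_mono)
      fix k assume k: "k \<in> W"
      have bk: "b k > 0" using b(1) k WN by auto
      have "\<bar>p k - g * b k\<bar> = \<bar>G k - g\<bar> * b k"
        using bk by (simp add: pG[OF k] left_diff_distrib[symmetric] abs_mult)
      also have "\<dots> \<le> (B * \<bar>real k - real c\<bar> / real n * g) * b k" using Gdiff[OF k] bk by (intro mult_right_mono) auto
      finally show "\<bar>p k - g * b k\<bar> \<le> g * B / real n * (b k * \<bar>real k - real c\<bar>)" by (simp add: mult_ac)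
    qed
    also have "\<dots> = g * B / real n * (\<Sum>k\<in>W. b k * \<bar>real k - real c\<bar>)" by (simp add: sum_distrib_left)
    also have "\<dots> \<le> g * B / real n * (\<Sum>k\<le>N. b k * \<bar>real k - real c\<bar>)"
      using g B WN b(1) by (intro mult_left_mono sum_mono2) (auto simp: less_imp_le)
    also have "\<dots> \<le> g * B / real n * ((K * real n / r + r) / 2)"
      using g B b r by (intro mult_left_mono sum_abs_deviation_le) (auto simp: less_imp_le)
    also have "K * real n / r + r = (K + 1) * r" using r by (simp add: field_simps flip: r(2))
    also have "g * B / real n * ((K + 1) * r / 2) = g * \<eta>" unfolding \<eta>_def r(2)[symmetric] using r(1) by (simp add: field_simps)
    finally show ?thesis .
  qed
  have tail: "(\<Sum>k\<in>T. f k) \<le> \<tau>"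
    if f: "\<And>k. k \<le> N \<Longrightarrow> f k \<ge> 0" "(\<Sum>k\<le>N. f k * (real k - real c)\<^sup>2) \<le> K * real n" for f
  proof -
    have "(\<Sum>k\<in>T. f k) \<le> K * real n / (real n / 16)\<^sup>2"
      using f n outside by (intro sum_tail_le[of "{..N}"]) (auto simp: T_def W_def)
    also have "\<dots> = 256 * K / real n" using n by (simp add: field_simps power2_eq_square)
    also have "\<dots> \<le> \<tau>" 
    proof -
      have "r * 1 \<le> r * r" using r(1,3) by (intro mult_left_mono) auto
      then show ?thesis unfolding \<tau>_def using n r by (intro divide_left_mono) simp_all
    qed
    finally show ?thesis .
  qed
  have tp: "(\<Sum>k\<in>T. p k) \<le> \<tau>" by (rule tail[OF p(1,3)])
  have tb: "(\<Sum>k\<in>T. b k) \<le> \<tau>" by (rule tail[OF less_imp_le[OF b(1)] b(3)])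
  define P where "P = (\<Sum>k\<in>W. p k)"
  define Q where "Q = (\<Sum>k\<in>W. b k)"
  have P: "P \<le> 1" "1 - \<tau> \<le> P" using p(2) split[of p] tp sum_nonneg[of T p] p(1) by (auto simp: P_def T_def)
  have Q: "Q \<le> 1" "1 - \<tau> \<le> Q" using b(2) split[of b] tb sum_nonneg[of T b] b(1) by (auto simp: Q_def T_def less_imp_le)
  have PQ: "\<bar>P - g * Q\<bar> \<le> g * \<eta>"
    unfolding P_def Q_def sum_distrib_left sum_subtractf[symmetric] by (rule order_trans[OF sum_abs near])
  \<comment> \<open>If the errors are small then \<open>g \<le> 2\<close>; otherwise the trivial bound 2 for the distance is good enough.\<close>
  have final: "(\<Sum>k\<le>N. \<bar>p k - b k\<bar>) \<le> 4 * \<eta> + 5 * \<tau>"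
  proof (cases "\<eta> + \<tau> \<le> 1 / 2")
    case True
    have "g * (1 - \<tau>) \<le> g * Q" using Q g by simp
    then have "g * (1 - \<tau> - \<eta>) \<le> 1" using PQ P by (simp add: algebra_simps)
    moreover have "g * (1 / 2) \<le> g * (1 - \<tau> - \<eta>)" using True g by (intro mult_left_mono) auto
    ultimately have g2: "g \<le> 2" by simp
    have ge: "g * \<eta> \<le> 2 * \<eta>" and gt: "g * \<tau> \<le> 2 * \<tau>" using g2 \<eta>0 \<tau>0 by (simp_all add: mult_right_mono)
    have "g * (1 - Q) \<le> g * \<tau>" using Q g by (intro mult_left_mono) auto
    moreover have "0 \<le> g * (1 - Q)" using Q g by simp
    ultimately have g1: "\<bar>g - 1\<bar> \<le> 2 * \<eta> + 3 * \<tau>"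
      using PQ P ge gt \<eta>0 \<tau>0 by (simp add: abs_le_iff algebra_simps)
    have "(\<Sum>k\<in>W. \<bar>p k - b k\<bar>) \<le> (\<Sum>k\<in>W. \<bar>p k - g * b k\<bar> + \<bar>g - 1\<bar> * b k)"
    proof (rule sum_mono)
      fix k assume "k \<in> W"
      then have "b k > 0" using b(1) WN by auto
      then have "\<bar>(g - 1) * b k\<bar> = \<bar>g - 1\<bar> * b k" by (simp add: abs_mult)
      moreover have "p k - b k = (p k - g * b k) + (g - 1) * b k" by (simp add: algebra_simps)
      ultimately show "\<bar>p k - b k\<bar> \<le> \<bar>p k - g * b k\<bar> + \<bar>g - 1\<bar> * b k" by linarith
    qed
    also have "\<dots> = (\<Sum>k\<in>W. \<bar>p k - g * b k\<bar>) + \<bar>g - 1\<bar> * Q"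
      by (simp add: sum.distrib sum_distrib_left Q_def)
    also have "\<dots> \<le> 2 * \<eta> + (2 * \<eta> + 3 * \<tau>)"
    proof -
      have "\<bar>g - 1\<bar> * Q \<le> \<bar>g - 1\<bar> * 1" using Q by (intro mult_left_mono) auto
      then have "\<bar>g - 1\<bar> * Q \<le> 2 * \<eta> + 3 * \<tau>" using g1 by (simp only: mult_1_right)
      then show ?thesis by (rule add_mono[OF order_trans[OF near ge]])
    qed
    finally have w: "(\<Sum>k\<in>W. \<bar>p k - b k\<bar>) \<le> 4 * \<eta> + 3 * \<tau>" by simp
    have "(\<Sum>k\<in>T. \<bar>p k - b k\<bar>) \<le> (\<Sum>k\<in>T. p k + b k)"
    proof (rule sum_mono)
      fix k assume "k \<in> T"
      then have "p k \<ge> 0" "b k > 0" using p(1) b(1) by (auto simp: T_def)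
      then show "\<bar>p k - b k\<bar> \<le> p k + b k" by linarith
    qed
    then have "(\<Sum>k\<in>T. \<bar>p k - b k\<bar>) \<le> 2 * \<tau>" using tp tb by (simp add: sum.distrib)
    with w show ?thesis unfolding split by linarith
  next
    case False
    have "(\<Sum>k\<le>N. \<bar>p k - b k\<bar>) \<le> (\<Sum>k\<le>N. p k + b k)"
    proof (rule sum_mono)
      fix k assume "k \<in> {..N}"
      then have "p k \<ge> 0" "b k > 0" using p(1) b(1) by auto
      then show "\<bar>p k - b k\<bar> \<le> p k + b k" by linarith
    qed
    also have "\<dots> = 2" by (simp add: sum.distrib p(2) b(2))
    finally show ?thesis using False \<tau>0 by linarith
  qed
  also have "\<dots> = (2 * B * (K + 1) + 1280 * K) / r"
    unfolding \<eta>_def \<tau>_def using r by (simp add: field_simps)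
  finally show ?thesis by (simp add: r_def)
qed

lemma expectation_pmf_nat:
  fixes f :: "nat \<Rightarrow> 'a :: {banach, second_countable_topology}"
  assumes "set_pmf M \<subseteq> {..N}"
  shows "measure_pmf.expectation M f = (\<Sum>k\<le>N. pmf M k *\<^sub>R f k)"
  using assms by (intro integral_measure_pmf) blast+

lemma sum_pmf_nat: "set_pmf M \<subseteq> {..N} \<Longrightarrow> (\<Sum>k\<le>N. pmf M k) = (1 :: real)" for N :: nat
  by (rule sum_pmf_eq_1) simp_all

lemma second_moment_about:
  fixes c :: real
  assumes M: "set_pmf M \<subseteq> {..N}"
  shows "(\<Sum>k\<le>N. pmf M k * (real k - c)\<^sup>2)
     \<le> 2 * measure_pmf.variance M real + 2 * (measure_pmf.expectation M real - c)\<^sup>2"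
proof -
  define m where "m = measure_pmf.expectation M real"
  have "(real k - c)\<^sup>2 \<le> 2 * (real k - m)\<^sup>2 + 2 * (m - c)\<^sup>2" for k
    using zero_le_power2[of "(real k - m) - (m - c)"] by (simp add: power2_eq_square algebra_simps)
  then have "(\<Sum>k\<le>N. pmf M k * (real k - c)\<^sup>2) \<le> (\<Sum>k\<le>N. pmf M k * (2 * (real k - m)\<^sup>2 + 2 * (m - c)\<^sup>2))"
    by (intro sum_mono mult_left_mono) auto
  also have "\<dots> = 2 * (\<Sum>k\<le>N. pmf M k * (real k - m)\<^sup>2) + 2 * (m - c)\<^sup>2 * (\<Sum>k\<le>N. pmf M k)"
    unfolding sum_distrib_left sum.distrib[symmetric] by (simp add: algebra_simps)
  also have "(\<Sum>k\<le>N. pmf M k * (real k - m)\<^sup>2) = measure_pmf.variance M real"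
    by (subst expectation_pmf_nat[OF M]) (simp add: m_def)
  finally show ?thesis by (simp add: sum_pmf_nat[OF M] m_def)
qed

lemma quarter_div: "\<bar>real (n div 4) - real n / 4\<bar> \<le> 1"
proof -
  have "n = 4 * (n div 4) + n mod 4" by simp
  then have "real n = 4 * real (n div 4) + real (n mod 4)" by (metis of_nat_add of_nat_mult of_nat_numeral)
  moreover have "real (n mod 4) < 4" by simp
  ultimately show ?thesis unfolding abs_le_iff by linarith
qed

text \<open>The exact difference is \<open>(4 - 5 n) / (4 (2 n - 1))\<close>, which tends to \<open>- 5 / 8\<close>.\<close>

lemma law_mean_bounds:
  assumes n: "n \<ge> 2"
  shows "\<bar>measure_pmf.expectation (double_deficiency_law n) real - real n / 4\<bar> \<le> 1"
proof -
  define x where "x = real n"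
  have x: "x \<ge> 2" using n by (simp add: x_def)
  have "(x - 1) * (x - 2) / (2 * (2 * x - 1)) - x / 4 = (4 - 5 * x) / (4 * (2 * x - 1))"
    using x by (simp add: divide_simps) (simp add: algebra_simps)
  moreover have "\<bar>(4 - 5 * x) / (4 * (2 * x - 1))\<bar> \<le> 1"
    using x by (simp add: abs_le_iff divide_simps)
  ultimately show ?thesis unfolding double_deficiency_moments(1)[OF n] x_def by simp
qed

lemma law_variance_le:
  assumes n: "n \<ge> 2"
  shows "measure_pmf.variance (double_deficiency_law n) real \<le> 3 * real n"
proof -
  define x where "x = real n"
  have x: "x \<ge> 2" using n by (simp add: x_def)
  have "(x + 1) * (x - 2) * (3 * x\<^sup>2 - 8 * x + 3) \<le> (2 * x * x) * (3 * x\<^sup>2)"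
  proof (rule order_trans[OF mult_left_mono mult_right_mono])
    show "3 * x\<^sup>2 - 8 * x + 3 \<le> 3 * x\<^sup>2" "0 \<le> (x + 1) * (x - 2)" "0 \<le> 3 * x\<^sup>2" using x by auto
    show "(x + 1) * (x - 2) \<le> 2 * x * x" using x by (intro mult_mono) auto
  qed
  also have "\<dots> \<le> 3 * x * (2 * (2 * x - 1)\<^sup>2 * (2 * x - 3))"
  proof -
    have "(3 / 2 * x)\<^sup>2 \<le> (2 * x - 1)\<^sup>2" using x by (intro power_mono) auto
    then have "(3 / 2 * x)\<^sup>2 * (x / 2) \<le> (2 * x - 1)\<^sup>2 * (2 * x - 3)" using x by (intro mult_mono) auto
    moreover have "x\<^sup>2 * x \<le> (3 / 2 * x)\<^sup>2 * (x / 2)" using x by (simp add: power2_eq_square)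
    ultimately have "x\<^sup>2 * x \<le> (2 * x - 1)\<^sup>2 * (2 * x - 3)" by (rule order_trans[rotated])
    then have "6 * x * (x\<^sup>2 * x) \<le> 6 * x * ((2 * x - 1)\<^sup>2 * (2 * x - 3))"
      using x by (intro mult_left_mono) auto
    moreover have "6 * x * (x\<^sup>2 * x) = (2 * x * x) * (3 * x\<^sup>2)"
      "6 * x * ((2 * x - 1)\<^sup>2 * (2 * x - 3)) = 3 * x * (2 * (2 * x - 1)\<^sup>2 * (2 * x - 3))"
      by (simp_all only: power2_eq_square mult_ac)
    ultimately show ?thesis by (simp only:)
  qed
  finally have "(x + 1) * (x - 2) * (3 * x\<^sup>2 - 8 * x + 3) / (2 * (2 * x - 1)\<^sup>2 * (2 * x - 3)) \<le> 3 * x"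
    using x by (subst pos_divide_le_eq) auto
  then show ?thesis unfolding double_deficiency_moments(2)[OF n] x_def .
qed

text \<open>The moments of Bernstein polynomials from the proof of the Weierstrass theorem are binomial moments.\<close>

lemma binomial_second_moment:
  fixes c :: real
  shows "(\<Sum>k\<le>N. pmf (binomial_pmf N (1 / 4)) k * (real k - c)\<^sup>2) = (real N / 4 - c)\<^sup>2 + 3 / 16 * real N"
proof -
  have B: "pmf (binomial_pmf N (1 / 4)) k = Bernstein N k (1 / 4)" for k
    by (simp add: Bernstein_def)
  have "(\<Sum>k\<le>N. pmf (binomial_pmf N (1 / 4)) k * (real k - c)\<^sup>2)
    = (\<Sum>k\<le>N. real k * (real k - 1) * Bernstein N k (1 / 4)) + (1 - 2 * c) * (\<Sum>k\<le>N. real k * Bernstein N k (1 / 4))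
       + c\<^sup>2 * (\<Sum>k\<le>N. Bernstein N k (1 / 4))"
    unfolding B sum_distrib_left sum.distrib[symmetric]
    by (intro sum.cong) (simp_all add: power2_eq_square algebra_simps)
  also have "\<dots> = real N * (real N - 1) * (1 / 4)\<^sup>2 + (1 - 2 * c) * (real N * (1 / 4)) + c\<^sup>2"
    unfolding sum_k_Bernstein sum_kk_Bernstein sum_Bernstein by simp
  also have "\<dots> = (real N / 4 - c)\<^sup>2 + 3 / 16 * real N"
    by (simp add: power2_eq_square field_simps)
  finally show ?thesis .
qed

text \<open>The constant of \<open>l1_distance_from_slow_ratio\<close> for \<open>K = 8\<close> and \<open>L = 496\<close>.\<close>

definition tv_constant :: real where
  "tv_constant = 2 * (2 * 496 * exp (2 * 496)) * (8 + 1) + 1280 * 8"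

text \<open>The window runs from \<open>n / 8\<close> to \<open>n / 2\<close> around \<open>n / 4\<close>; inside it both \<open>k\<close> and \<open>n - 2 - k\<close> are of order \<open>n\<close>.
  The threshold 992 is \<open>2 L\<close>.\<close>

lemma law_binomial_l1:
  assumes n: "n \<ge> 992"
  shows "(\<Sum>k\<le>n - 2. \<bar>pmf (double_deficiency_law n) k - pmf (binomial_pmf (n - 2) (1 / 4)) k\<bar>)
     \<le> tv_constant / sqrt n"
proof -
  define p where "p = pmf (double_deficiency_law n)"
  define b where "b = pmf (binomial_pmf (n - 2) (1 / 4))"
  have n2: "n \<ge> 2" using n by simp
  have suppL: "set_pmf (double_deficiency_law n) \<subseteq> {..n - 2}"
    using set_pmf_double_deficiency_law[OF n2] by simp
  have suppB: "set_pmf (binomial_pmf (n - 2) (1 / 4)) \<subseteq> {..n - 2}" by simp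
  have div: "8 * (n div 8) \<le> n" "n < 8 * (n div 8) + 8" "4 * (n div 4) \<le> n" "n < 4 * (n div 4) + 4"
     "2 * (n div 2) \<le> n" "n < 2 * (n div 2) + 2"
    by linarith+
  have c: "\<bar>real (n div 4) - real n / 4\<bar> \<le> 1" by (rule quarter_div)
  have "(\<Sum>k\<le>n - 2. \<bar>p k - b k\<bar>) \<le> (2 * (2 * 496 * exp (2 * 496)) * (8 + 1) + 1280 * 8) / sqrt n"
  proof (rule l1_distance_from_slow_ratio[where c = "n div 4" and lo = "n div 8" and hi = "n div 2"])
    show "(\<Sum>k\<le>n - 2. p k) = 1" "(\<Sum>k\<le>n - 2. b k) = 1"
      unfolding p_def b_def by (rule sum_pmf_nat[OF suppL], rule sum_pmf_nat[OF suppB])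
    show "p k \<ge> 0" for k by (simp add: p_def)
    show "b k > 0" if "k \<le> n - 2" for k using that by (simp add: b_def)
    show "(\<Sum>k\<le>n - 2. p k * (real k - real (n div 4))\<^sup>2) \<le> 8 * real n"
    proof -
      define m where "m = measure_pmf.expectation (double_deficiency_law n) real"
      have "\<bar>m - real (n div 4)\<bar> \<le> 2" using law_mean_bounds[OF n2] c unfolding m_def by linarith
      then have "(m - real (n div 4))\<^sup>2 \<le> 2\<^sup>2" using power_mono[of "\<bar>m - real (n div 4)\<bar>" 2 2] by simp
      then show ?thesis
        using second_moment_about[OF suppL, of "real (n div 4)"] law_variance_le[OF n2] n
        unfolding m_def p_def by simp
    qed
    show "(\<Sum>k\<le>n - 2. b k * (real k - real (n div 4))\<^sup>2) \<le> 8 * real n"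
    proof -
      have "\<bar>real (n - 2) / 4 - real (n div 4)\<bar> \<le> 2" 
      proof -
        have "real (n - 2) = real n - 2" using n by (simp add: of_nat_diff)
        then show ?thesis using c unfolding abs_le_iff by linarith
      qed
      then have "(real (n - 2) / 4 - real (n div 4))\<^sup>2 \<le> 4" using power_mono[of "\<bar>real (n - 2) / 4 - real (n div 4)\<bar>" 2 2] by simp
      moreover have "real (n - 2) \<le> real n" "992 \<le> real n" using n by simp_all
      ultimately show ?thesis unfolding b_def binomial_second_moment by linarith
    qed
    show "n div 8 \<le> n div 4" "n div 4 < n div 2" "n div 2 \<le> n - 2" "n div 2 \<le> n" using n div by linarith+
    show "real n / 16 \<le> \<bar>real k - real (n div 4)\<bar>" if "k < n div 8 \<or> n div 2 < k" for k
      using that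
    proof
      assume "k < n div 8"
      then have "16 * k + n \<le> 16 * (n div 4)" using div n by linarith
      then have "16 * real k + real n \<le> 16 * real (n div 4)" by (metis of_nat_add of_nat_mono of_nat_mult of_nat_numeral)
      then show ?thesis by linarith
    next
      assume "n div 2 < k"
      then have "16 * (n div 4) + n \<le> 16 * k" using div n by linarith
      then have "16 * real (n div 4) + real n \<le> 16 * real k" by (metis of_nat_add of_nat_mono of_nat_mult of_nat_numeral)
      then show ?thesis by linarith
    qed
    fix k assume k: "n div 8 \<le> k" "k < n div 2"
    have k': "k \<ge> 1" "k + 1 \<le> n - 2" "n \<le> 16 * k" "n \<le> 4 * (n - 2 - k)" using k div n by linarith+
    note step = law_binomial_ratio_step[OF k'(1,2)]
    show pos: "0 < p k / b k" using step(2) by (simp add: p_def b_def)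
    \<comment> \<open>The constant 496 is \<open>100 * 4 + 6 * 16\<close>.\<close>
    have "real n \<le> 16 * real k" "real n \<le> 4 * real (n - 2 - k)"
      using k'(3,4) by (metis of_nat_mono of_nat_mult of_nat_numeral)+
    then have "100 / real (n - 2 - k) \<le> 400 / real n" "6 / real k \<le> 96 / real n"
      using n k' by (simp_all add: divide_simps)
    then have "100 / real (n - 2 - k) + 6 / real k \<le> 496 / real n" by (simp add: add_divide_distrib[symmetric])
    then have "(100 / real (n - 2 - k) + 6 / real k) * (p k / b k) \<le> 496 / real n * (p k / b k)"
      using pos by (intro mult_right_mono) auto
    then show "\<bar>p (Suc k) / b (Suc k) - p k / b k\<bar> \<le> 496 / real n * (p k / b k)"
      using step(1) unfolding p_def b_def Suc_eq_plus1 by linarith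
  qed (use n in auto)
  then show ?thesis by (simp only: p_def b_def tv_constant_def)
qed

lemma d_TV_eq_sum:
  assumes "set_pmf M \<subseteq> {..N}" "set_pmf M' \<subseteq> {..N}"
  shows "d_TV (map_pmf int M) (map_pmf int M') = 1 / 2 * (\<Sum>k\<le>N. \<bar>pmf M k - pmf M' k\<bar>)"
proof -
  have pm: "pmf (map_pmf int M) (int k) = pmf M k" for M k by (rule pmf_map_inj') simp
  have z: "pmf (map_pmf int Q) j = 0" if "set_pmf Q \<subseteq> {..N}" "j \<notin> int ` {..N}" for Q j
    using that by (auto simp: set_pmf_iff[symmetric] pmf_eq_0_set_pmf)
  have "(\<Sum>\<^sub>\<infinity>j. \<bar>pmf (map_pmf int M) j - pmf (map_pmf int M') j\<bar>)
     = (\<Sum>\<^sub>\<infinity>j\<in>int ` {..N}. \<bar>pmf (map_pmf int M) j - pmf (map_pmf int M') j\<bar>)"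
    by (rule infsum_cong_neutral) (use z assms in auto)
  also have "\<dots> = (\<Sum>k\<le>N. \<bar>pmf M k - pmf M' k\<bar>)"
    by (simp add: sum.reindex pm)
  finally show ?thesis by (simp add: d_TV_def)
qed

text \<open>The distance is in fact \<open>O(n\<^sup>-\<^sup>1\<^sup>/\<^sup>2)\<close>, and the logarithm is at least 1 for the \<open>n\<close> considered.\<close>

lemma d_TV_bigo:
  "(\<lambda>n. d_TV (map_pmf int (double_deficiency_law n)) (map_pmf int (binomial_pmf (n - 2) (1 / 4))))
     \<in> O(\<lambda>n. real n powr (- 1 / 2) * ln (real n) powr (1 / 4))"
proof (rule bigoI[where c = "tv_constant / 2"])
  have "tv_constant \<ge> 0" by (simp add: tv_constant_def)
  show "eventually (\<lambda>n. norm (d_TV (map_pmf int (double_deficiency_law n)) (map_pmf int (binomial_pmf (n - 2) (1 / 4))))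
     \<le> tv_constant / 2 * norm (real n powr (- 1 / 2) * ln (real n) powr (1 / 4))) sequentially"
    using eventually_ge_at_top[of 992]
  proof eventually_elim
    case (elim n)
    have "n \<ge> 2" using elim by simp
    then have supp: "set_pmf (double_deficiency_law n) \<subseteq> {..n - 2}"
      using set_pmf_double_deficiency_law by simp
    let ?d = "d_TV (map_pmf int (double_deficiency_law n)) (map_pmf int (binomial_pmf (n - 2) (1 / 4)))"
    define S where "S = (\<Sum>k\<le>n - 2. \<bar>pmf (double_deficiency_law n) k - pmf (binomial_pmf (n - 2) (1 / 4)) k\<bar>)"
    have d: "?d = 1 / 2 * S" unfolding S_def by (rule d_TV_eq_sum[OF supp]) simp
    have "0 \<le> S" unfolding S_def by (intro sum_nonneg) simp
    moreover have "S \<le> tv_constant / sqrt n" unfolding S_def by (rule law_binomial_l1[OF elim])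
    ultimately have nd: "norm ?d \<le> tv_constant / 2 * (1 / sqrt n)" unfolding d by simp
    have sq: "real n powr (- 1 / 2) = 1 / sqrt n"
    proof -
      have "real n powr (- (1 / 2)) = 1 / real n powr (1 / 2)" by (rule powr_minus_divide)
      also have "real n powr (1 / 2) = sqrt n" by (rule powr_half_sqrt) simp
      finally show ?thesis by simp
    qed
    have "real n powr (- 1 / 2) \<le> norm (real n powr (- 1 / 2) * ln (real n) powr (1 / 4))"
    proof -
      have "992 \<le> real n" using elim by simp
      then have "exp 1 \<le> real n" using exp_le by linarith
      then have "1 \<le> ln (real n)" using \<open>992 \<le> real n\<close> by (subst ln_ge_iff) auto
      then have one: "1 \<le> ln (real n) powr (1 / 4)" by (intro ge_one_powr_ge_zero) auto
      show ?thesis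
        using mult_left_mono[OF one, of "real n powr (- 1 / 2)"] by (simp add: abs_mult)
    qed
    then have "tv_constant / 2 * (1 / sqrt n) \<le> tv_constant / 2 * norm (real n powr (- 1 / 2) * ln (real n) powr (1 / 4))"
      unfolding sq using \<open>tv_constant \<ge> 0\<close> by (intro mult_left_mono) simp_all
    with nd show ?case by (rule order_trans)
  qed
qed

section \<open>Asymptotic normality\<close>

lemma char_standardised_pmf:
  assumes "set_pmf M \<subseteq> {..N}"
  shows "char (distr (measure_pmf M) borel (\<lambda>k. (real k - m) / s)) t
     = (\<Sum>k\<le>N. pmf M k *\<^sub>R iexp (t / s * (real k - m)))"
proof -
  have "char (distr (measure_pmf M) borel (\<lambda>k. (real k - m) / s)) t
      = measure_pmf.expectation M (\<lambda>k. iexp (t * ((real k - m) / s)))"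
    unfolding char_def by (subst integral_distr) auto
  then show ?thesis by (simp add: expectation_pmf_nat[OF assms])
qed

lemma char_difference_le:
  "norm ((\<Sum>k\<le>N. p k *\<^sub>R iexp (f k)) - (\<Sum>k\<le>N. b k *\<^sub>R iexp (f k))) \<le> (\<Sum>k\<le>N. \<bar>p k - b k\<bar>)"
  for N :: nat
proof -
  have "(\<Sum>k\<le>N. p k *\<^sub>R iexp (f k)) - (\<Sum>k\<le>N. b k *\<^sub>R iexp (f k)) = (\<Sum>k\<le>N. (p k - b k) *\<^sub>R iexp (f k))"
    by (simp add: scaleR_diff_left sum_subtractf)
  also have "norm \<dots> \<le> (\<Sum>k\<le>N. norm ((p k - b k) *\<^sub>R iexp (f k)))"
    by (rule norm_sum)
  also have "\<dots> = (\<Sum>k\<le>N. \<bar>p k - b k\<bar>)" by simp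
  finally show ?thesis .
qed

text \<open>The characteristic function of \<open>\<xi> - 1 / 4\<close> for a Bernoulli variable \<open>\<xi>\<close> with parameter \<open>1 / 4\<close>.\<close>

definition centred_step_char :: "real \<Rightarrow> complex" where
  "centred_step_char x = 1 / 4 * iexp (3 / 4 * x) + 3 / 4 * iexp (- (1 / 4) * x)"

lemma binomial_char:
  "(\<Sum>k\<le>N. pmf (binomial_pmf N (1 / 4)) k *\<^sub>R iexp (x * (real k - m)))
     = centred_step_char x ^ N * iexp (x * (real N / 4 - m))"
proof -
  have "pmf (binomial_pmf N (1 / 4)) k *\<^sub>R iexp (x * (real k - m))
     = of_nat (N choose k) * (1 / 4 * iexp (3 / 4 * x)) ^ k * (3 / 4 * iexp (- (1 / 4) * x)) ^ (N - k) * iexp (x * (real N / 4 - m))"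
    if "k \<le> N" for k
  proof -
    have key: "iexp (3 / 4 * x) ^ k * iexp (- (1 / 4) * x) ^ (N - k) * iexp (x * (real N / 4 - m)) = iexp (x * (real k - m))"
      unfolding exp_of_nat_mult[symmetric] exp_add[symmetric]
      using that by (intro arg_cong[where f = exp]) (simp add: of_nat_diff field_simps)
    have "pmf (binomial_pmf N (1 / 4)) k = real (N choose k) * (1 / 4) ^ k * (3 / 4) ^ (N - k)" by simp
    then show ?thesis
      unfolding key[symmetric] scaleR_conv_of_real power_mult_distrib by (simp add: mult_ac)
  qed
  then show ?thesis
    unfolding centred_step_char_def binomial_ring sum_distrib_right by (intro sum.cong) auto
qed

lemma centred_step_char_norm_le: "norm (centred_step_char x) \<le> 1"
proof -
  have "norm (centred_step_char x) \<le> norm (1 / 4 * iexp (3 / 4 * x)) + norm (3 / 4 * iexp (- (1 / 4) * x))"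
    unfolding centred_step_char_def by (rule norm_triangle_ineq)
  also have "\<dots> = 1" unfolding norm_mult norm_exp_i_times by simp
  finally show ?thesis .
qed

lemma centred_step_char_approx:
  "norm (centred_step_char x - complex_of_real (1 - 3 / 32 * x\<^sup>2)) \<le> \<bar>x\<bar> ^ 3"
proof -
  have ap: "norm (iexp y - complex_of_real (1 - y\<^sup>2 / 2) - \<i> * complex_of_real y) \<le> \<bar>y\<bar> ^ 3 / 6" for y
    using iexp_approx1[of y 2]
    by (simp add: numeral_2_eq_2 numeral_3_eq_3 fact_numeral power2_eq_square algebra_simps)
  have small: "\<bar>c * x\<bar> ^ 3 / 6 \<le> \<bar>x\<bar> ^ 3" if "\<bar>c\<bar> \<le> 1" for c
  proof -
    have "\<bar>c * x\<bar> ^ 3 \<le> \<bar>x\<bar> ^ 3"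
      using mult_right_mono[OF that, of "\<bar>x\<bar>"] by (intro power_mono) (simp_all add: abs_mult)
    moreover have "0 \<le> \<bar>x\<bar> ^ 3" by simp
    ultimately show ?thesis by linarith
  qed
  define u where "u = iexp (3 / 4 * x) - complex_of_real (1 - (3 / 4 * x)\<^sup>2 / 2) - \<i> * complex_of_real (3 / 4 * x)"
  define v where "v = iexp (- (1 / 4) * x) - complex_of_real (1 - (- (1 / 4) * x)\<^sup>2 / 2) - \<i> * complex_of_real (- (1 / 4) * x)"
  have "centred_step_char x - complex_of_real (1 - 3 / 32 * x\<^sup>2) = 1 / 4 * u + 3 / 4 * v"
    by (simp add: centred_step_char_def u_def v_def power2_eq_square algebra_simps)
  also have "norm \<dots> \<le> norm (1 / 4 * u) + norm (3 / 4 * v)" by (rule norm_triangle_ineq)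
  also have "\<dots> = 1 / 4 * norm u + 3 / 4 * norm v" unfolding norm_mult by simp
  also have "\<dots> \<le> 1 / 4 * (\<bar>x\<bar> ^ 3) + 3 / 4 * (\<bar>x\<bar> ^ 3)"
  proof (intro add_mono mult_left_mono)
    have "norm u \<le> \<bar>3 / 4 * x\<bar> ^ 3 / 6" unfolding u_def by (rule ap)
    also have "\<dots> \<le> \<bar>x\<bar> ^ 3" by (rule small) simp
    finally show "norm u \<le> \<bar>x\<bar> ^ 3" .
    have "norm v \<le> \<bar>- (1 / 4) * x\<bar> ^ 3 / 6" unfolding v_def by (rule ap)
    also have "\<dots> \<le> \<bar>x\<bar> ^ 3" by (rule small) simp
    finally show "norm v \<le> \<bar>x\<bar> ^ 3" .
  qed auto
  finally show ?thesis by simp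
qed

text \<open>Telescoping replaces an \<open>N\<close>-th power by \<open>N\<close> times the error of a single factor, a third order Taylor remainder.\<close>

lemma centred_step_char_power:
  "norm (centred_step_char x ^ N - complex_of_real (exp (- (3 / 32 * (real N * x\<^sup>2))))) \<le> real N * (\<bar>x\<bar> ^ 3 + x ^ 4)"
proof -
  define y where "y = 3 / 32 * x\<^sup>2"
  have y: "y \<ge> 0" by (simp add: y_def)
  have ey: "\<bar>1 - y - exp (- y)\<bar> \<le> x ^ 4"
  proof -
    have "1 - y \<le> exp (- y)" using exp_ge_add_one_self[of "- y"] by simp
    moreover have "exp (- y) \<le> 1 - y + y\<^sup>2"
    proof -
      have "exp (- y) \<le> 1 / (1 + y)"
        using exp_ge_add_one_self[of y] y by (simp add: exp_minus divide_simps)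
      also have "\<dots> \<le> 1 - y + y\<^sup>2"
        using y by (simp add: divide_simps power2_eq_square algebra_simps)
      finally show ?thesis .
    qed
    moreover have "y\<^sup>2 = (3 / 32)\<^sup>2 * x ^ 4" by (simp add: y_def power2_eq_square power4_eq_xxxx)
    moreover have "(3 / 32)\<^sup>2 * x ^ 4 \<le> 1 * x ^ 4" by (intro mult_right_mono) (auto simp: power2_eq_square)
    ultimately show ?thesis by (simp add: abs_le_iff)
  qed
  have pow: "complex_of_real (exp (- (3 / 32 * (real N * x\<^sup>2)))) = complex_of_real (exp (- y)) ^ N"
    unfolding of_real_power[symmetric] exp_of_nat_mult[symmetric] by (simp add: y_def mult_ac)
  have "norm (centred_step_char x ^ N - complex_of_real (exp (- y)) ^ N) \<le> real N * norm (centred_step_char x - complex_of_real (exp (- y)))"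
    by (rule norm_power_diff) (use centred_step_char_norm_le y in auto)
  also have "norm (centred_step_char x - complex_of_real (exp (- y))) \<le> \<bar>x\<bar> ^ 3 + x ^ 4"
  proof -
    have "centred_step_char x - complex_of_real (exp (- y)) = (centred_step_char x - complex_of_real (1 - y)) + complex_of_real (1 - y - exp (- y))"
      by simp
    also have "norm \<dots> \<le> norm (centred_step_char x - complex_of_real (1 - y)) + norm (complex_of_real (1 - y - exp (- y)))"
      by (rule norm_triangle_ineq)
    also have "norm (complex_of_real (1 - y - exp (- y))) \<le> x ^ 4" unfolding norm_of_real by (rule ey)
    also have "norm (centred_step_char x - complex_of_real (1 - y)) \<le> \<bar>x\<bar> ^ 3"
      unfolding y_def by (rule centred_step_char_approx)
    finally show ?thesis by simp
  qed
  finally show ?thesis unfolding pow by (simp add: mult_left_mono)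
qed

text \<open>The standardisation uses the mean \<open>m n\<close> and the standard deviation \<open>s n\<close> of the law itself, so the binomial
  variable is centred at the wrong point. The error \<open>(n - 2) / 4 - m n\<close> stays bounded and is divided by \<open>s n\<close>, hence
  contributes a factor tending to 1.\<close>

lemma asymptotically_normal_double_deficiency_law: "asymptotically_normal double_deficiency_law"
  unfolding asymptotically_normal_def
proof (rule levy_continuity)
  let ?L = double_deficiency_law
  define m where "m n = measure_pmf.expectation (?L n) real" for n
  define s where "s n = sqrt (measure_pmf.variance (?L n) real)" for n
  show "real_distribution (distr (measure_pmf (?L n)) borel
          (\<lambda>k. (real k - measure_pmf.expectation (?L n) real) / sqrt (measure_pmf.variance (?L n) real)))" for n
    by (rule prob_space.real_distribution_distr[OF prob_space_measure_pmf]) simp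
  show "real_distribution std_normal_distribution" by (rule real_dist_normal_dist)
  fix t :: real
  define M where "M n = distr (measure_pmf (?L n)) borel (\<lambda>k. (real k - m n) / s n)" for n
  define x where "x n = t / s n" for n
  define V where "V y = (y + 1) * (y - 2) * (3 * y ^ 2 - 8 * y + 3) / (2 * (2 * y - 1) ^ 2 * (2 * y - 3))" for y :: real
  have sV: "eventually (\<lambda>n. s n = sqrt (V (real n))) sequentially"
    using eventually_ge_at_top[of 2] by eventually_elim (simp only: s_def V_def double_deficiency_moments(2))
  have s0: "(\<lambda>n. 1 / s n) \<longlonglongrightarrow> 0"
  proof (rule Lim_transform_eventually)
    show "(\<lambda>n. 1 / sqrt (V (real n))) \<longlonglongrightarrow> 0" unfolding V_def by real_asymp
    show "\<forall>\<^sub>F n in sequentially. 1 / sqrt (V (real n)) = 1 / s n" using sV by eventually_elim simp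
  qed
  have l2: "(\<lambda>n. real (n - 2) * (1 / s n)\<^sup>2) \<longlonglongrightarrow> 16 / 3"
  proof (rule Lim_transform_eventually)
    show "(\<lambda>n. (real n - 2) / V (real n)) \<longlonglongrightarrow> 16 / 3" unfolding V_def by real_asymp
    show "\<forall>\<^sub>F n in sequentially. (real n - 2) / V (real n) = real (n - 2) * (1 / s n)\<^sup>2"
      using eventually_ge_at_top[of 2]
    proof eventually_elim
      case (elim n)
      have "(s n)\<^sup>2 = measure_pmf.variance (?L n) real"
        unfolding s_def by (rule real_sqrt_pow2) (rule measure_pmf.variance_positive)
      also have "\<dots> = V (real n)" unfolding V_def by (rule double_deficiency_moments(2)[OF elim])
      finally show ?case using elim by (simp add: power_divide of_nat_diff)
    qed
  qed
  have x0: "x \<longlonglongrightarrow> 0" using tendsto_mult_left[OF s0, of t] by (simp add: x_def[abs_def])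
  have x2: "(\<lambda>n. real (n - 2) * (x n)\<^sup>2) \<longlonglongrightarrow> 16 / 3 * t\<^sup>2"
    using tendsto_mult_right[OF l2, of "t\<^sup>2"] by (simp add: x_def power_divide mult_ac)
  have exp_lim: "(\<lambda>n. complex_of_real (exp (- (3 / 32 * (real (n - 2) * (x n)\<^sup>2))))) \<longlonglongrightarrow> complex_of_real (exp (- (t\<^sup>2) / 2))"
  proof -
    have "(\<lambda>n. complex_of_real (exp (- (3 / 32 * (real (n - 2) * (x n)\<^sup>2))))) \<longlonglongrightarrow> complex_of_real (exp (- (3 / 32 * (16 / 3 * t\<^sup>2))))"
      by (intro tendsto_intros x2)
    then show ?thesis by simp
  qed
  have err: "(\<lambda>n. real (n - 2) * (\<bar>x n\<bar> ^ 3 + x n ^ 4)) \<longlonglongrightarrow> 0"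
  proof -
    have "(\<lambda>n. real (n - 2) * (x n)\<^sup>2 * (\<bar>x n\<bar> + (x n)\<^sup>2)) \<longlonglongrightarrow> 16 / 3 * t\<^sup>2 * (\<bar>0\<bar> + 0\<^sup>2)"
      by (intro tendsto_intros x2 x0)
    moreover have "real (n - 2) * (x n)\<^sup>2 * (\<bar>x n\<bar> + (x n)\<^sup>2) = real (n - 2) * (\<bar>x n\<bar> ^ 3 + x n ^ 4)" for n
    proof -
      have "(x n)\<^sup>2 * (\<bar>x n\<bar> + (x n)\<^sup>2) = \<bar>x n\<bar> ^ 3 + x n ^ 4"
      proof -
        have "(x n)\<^sup>2 * \<bar>x n\<bar> = \<bar>x n\<bar>\<^sup>2 * \<bar>x n\<bar>" by simp
        also have "\<dots> = \<bar>x n\<bar> ^ 3" by (simp only: power2_eq_square power3_eq_cube)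
        finally have "(x n)\<^sup>2 * \<bar>x n\<bar> = \<bar>x n\<bar> ^ 3" .
        moreover have "(x n)\<^sup>2 * (x n)\<^sup>2 = x n ^ 4" by (simp only: power2_eq_square power4_eq_xxxx mult.assoc)
        ultimately show ?thesis by (simp only: distrib_left)
      qed
      then show ?thesis by (simp add: mult.assoc)
    qed
    ultimately show ?thesis by simp
  qed
  have pow_lim: "(\<lambda>n. centred_step_char (x n) ^ (n - 2)) \<longlonglongrightarrow> complex_of_real (exp (- (t\<^sup>2) / 2))"
  proof -
    have "(\<lambda>n. centred_step_char (x n) ^ (n - 2) - complex_of_real (exp (- (3 / 32 * (real (n - 2) * (x n)\<^sup>2))))) \<longlonglongrightarrow> 0"
      by (rule Lim_null_comparison[OF always_eventually err]) (intro allI centred_step_char_power)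
    from tendsto_add[OF this exp_lim] show ?thesis by simp
  qed
  have shift_lim: "(\<lambda>n. iexp (x n * (real (n - 2) / 4 - m n))) \<longlonglongrightarrow> 1"
  proof -
    have "(\<lambda>n. x n * (real (n - 2) / 4 - m n)) \<longlonglongrightarrow> 0"
    proof (rule Lim_null_comparison)
      show "(\<lambda>n. 2 * \<bar>x n\<bar>) \<longlonglongrightarrow> 0" using tendsto_mult_right_zero[OF tendsto_rabs_zero[OF x0], of 2] by simp
      show "\<forall>\<^sub>F n in sequentially. norm (x n * (real (n - 2) / 4 - m n)) \<le> 2 * \<bar>x n\<bar>"
        using eventually_ge_at_top[of 2]
      proof eventually_elim
        case (elim n)
        have "real (n - 2) = real n - 2" using elim by (simp add: of_nat_diff)
        then have "\<bar>real (n - 2) / 4 - m n\<bar> \<le> 2" using law_mean_bounds[OF elim] unfolding m_def by linarith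
        then have "\<bar>x n\<bar> * \<bar>real (n - 2) / 4 - m n\<bar> \<le> \<bar>x n\<bar> * 2" by (intro mult_left_mono) auto
        then show ?case by (simp add: abs_mult mult.commute)
      qed
    qed
    then have "(\<lambda>n. iexp (x n * (real (n - 2) / 4 - m n))) \<longlonglongrightarrow> iexp 0"
      by (intro tendsto_intros)
    then show ?thesis by simp
  qed
  define \<beta> where "\<beta> n = (\<Sum>k\<le>n - 2. pmf (binomial_pmf (n - 2) (1 / 4)) k *\<^sub>R iexp (x n * (real k - m n)))" for n
  have \<beta>_lim: "\<beta> \<longlonglongrightarrow> complex_of_real (exp (- (t\<^sup>2) / 2))"
    using tendsto_mult[OF pow_lim shift_lim] unfolding \<beta>_def[abs_def] binomial_char by simp
  have diff_lim: "(\<lambda>n. char (M n) t - \<beta> n) \<longlonglongrightarrow> 0"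
  proof (rule Lim_null_comparison)
    show "(\<lambda>n. tv_constant / sqrt (real n)) \<longlonglongrightarrow> 0" by real_asymp
    show "\<forall>\<^sub>F n in sequentially. norm (char (M n) t - \<beta> n) \<le> tv_constant / sqrt (real n)"
      using eventually_ge_at_top[of 992]
    proof eventually_elim
      case (elim n)
      have supp: "set_pmf (?L n) \<subseteq> {..n - 2}" using set_pmf_double_deficiency_law[of n] elim by simp
      show ?case
        unfolding M_def \<beta>_def char_standardised_pmf[OF supp] x_def
        by (rule order_trans[OF char_difference_le law_binomial_l1[OF elim]])
    qed
  qed
  have "(\<lambda>n. char (M n) t) \<longlonglongrightarrow> complex_of_real (exp (- (t\<^sup>2) / 2))"
    using tendsto_add[OF diff_lim \<beta>_lim] by simp
  then show "(\<lambda>n. char (distr (measure_pmf (?L n)) borel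
          (\<lambda>k. (real k - measure_pmf.expectation (?L n) real) / sqrt (measure_pmf.variance (?L n) real))) t)
      \<longlonglongrightarrow> char std_normal_distribution t"
    unfolding char_std_normal_distribution M_def m_def s_def .
qed

theorem proposition1:
  shows "(\<forall>n\<ge>2.
            set_pmf (double_deficiency_law n) = {0..n - 2} \<and>
            measure_pmf.expectation (double_deficiency_law n) real
              = (real n - 1) * (real n - 2) / (2 * (2 * real n - 1)) \<and>
            measure_pmf.variance (double_deficiency_law n) real
              = (real n + 1) * (real n - 2) * (3 * real n ^ 2 - 8 * real n + 3)
                  / (2 * (2 * real n - 1) ^ 2 * (2 * real n - 3))) \<and>
         (\<lambda>n. d_TV (map_pmf int (double_deficiency_law n))
                    (map_pmf int (binomial_pmf (n - 2) (1 / 4))))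
           \<in> O(\<lambda>n. real n powr (- 1 / 2) * ln (real n) powr (1 / 4)) \<and>
         asymptotically_normal double_deficiency_law"
proof (intro conjI allI impI)
  fix n :: nat assume n: "2 \<le> n"
  show "set_pmf (double_deficiency_law n) = {0..n - 2}"
    by (rule set_pmf_double_deficiency_law[OF n])
  show "measure_pmf.expectation (double_deficiency_law n) real
      = (real n - 1) * (real n - 2) / (2 * (2 * real n - 1))"
    by (rule double_deficiency_moments(1)[OF n])
  show "measure_pmf.variance (double_deficiency_law n) real
      = (real n + 1) * (real n - 2) * (3 * real n ^ 2 - 8 * real n + 3)
          / (2 * (2 * real n - 1) ^ 2 * (2 * real n - 3))"
    by (rule double_deficiency_moments(2)[OF n])
qed (rule d_TV_bigo asymptotically_normal_double_deficiency_law)+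

end
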